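(* Let $1\le p<\infty$. There exist an operator $T\in\mathfrak L(\ell_p(\mathbb Z_+))$ and a set $A\subset\mathbb N$ with positive lower density such that $T$ is frequently hypercyclic and chaotic, but $T$ is not frequently hypercyclic along $A$ (and thus not hereditarily frequently hypercyclic).
   Context: $\mathcal N_T(x,V):=\{n\in\mathbb N:T^nx\in V\}$. $T$ is frequently hypercyclic if some $x$ has $\mathcal N_T(x,V)$ of positive lower density for every non-empty open $V$; chaotic if it is hypercyclic (has a dense orbit) and has a dense set of periodic points. For $A\subset\mathbb N$ of positive lower density, $T$ is frequently hypercyclic along $A$ if there exists $x$ such that $A\cap\mathcal N_T(x,V)$ has positive lower density for every non-empty open set $V$. Hereditarily frequently hypercyclic: for every countable family $(V_i)$ of non-empty open sets and sets $A_i\subset\mathbb N$ of positive lower density, some $x$ has $\mathcal N_T(x,V_i)\cap A_i$ of positive lower density for all $i$. *)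

theory Defs
  imports "HOL-Analysis.Analysis"
begin

definition lp_space :: "real \<Rightarrow> (nat \<Rightarrow> complex) set" where
  "lp_space p = {x. summable (\<lambda>n. norm (x n) powr p)}"

definition lp_norm :: "real \<Rightarrow> (nat \<Rightarrow> complex) \<Rightarrow> real" where
  "lp_norm p x = (\<Sum>n. norm (x n) powr p) powr (1 / p)"

definition lp_open :: "real \<Rightarrow> (nat \<Rightarrow> complex) set \<Rightarrow> bool" where
  "lp_open p V \<longleftrightarrow> V \<subseteq> lp_space p \<and>
     (\<forall>x\<in>V. \<exists>e>0. \<forall>y\<in>lp_space p. lp_norm p (\<lambda>n. y n - x n) < e \<longrightarrow> y \<in> V)"

definition lp_operator :: "real \<Rightarrow> ((nat \<Rightarrow> complex) \<Rightarrow> (nat \<Rightarrow> complex)) \<Rightarrow> bool" where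
  "lp_operator p T \<longleftrightarrow>
     (\<forall>x\<in>lp_space p. T x \<in> lp_space p) \<and>
     (\<forall>x\<in>lp_space p. \<forall>y\<in>lp_space p. T (\<lambda>n. x n + y n) = (\<lambda>n. T x n + T y n)) \<and>
     (\<forall>c::complex. \<forall>x\<in>lp_space p. T (\<lambda>n. c * x n) = (\<lambda>n. c * T x n)) \<and>
     (\<exists>C. \<forall>x\<in>lp_space p. lp_norm p (T x) \<le> C * lp_norm p x)"

definition lower_density :: "nat set \<Rightarrow> ereal" where
  "lower_density A = liminf (\<lambda>N. ereal (real (card (A \<inter> {1..N})) / real N))"

definition return_set ::
  "((nat \<Rightarrow> complex) \<Rightarrow> (nat \<Rightarrow> complex)) \<Rightarrow> (nat \<Rightarrow> complex) \<Rightarrow> (nat \<Rightarrow> complex) set \<Rightarrow> nat set" where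
  "return_set T x V = {n. (T ^^ n) x \<in> V}"

definition hypercyclic :: "real \<Rightarrow> ((nat \<Rightarrow> complex) \<Rightarrow> (nat \<Rightarrow> complex)) \<Rightarrow> bool" where
  "hypercyclic p T \<longleftrightarrow> (\<exists>x\<in>lp_space p. \<forall>V. lp_open p V \<and> V \<noteq> {} \<longrightarrow> return_set T x V \<noteq> {})"

definition periodic_point :: "((nat \<Rightarrow> complex) \<Rightarrow> (nat \<Rightarrow> complex)) \<Rightarrow> (nat \<Rightarrow> complex) \<Rightarrow> bool" where
  "periodic_point T x \<longleftrightarrow> (\<exists>n>0. (T ^^ n) x = x)"

definition chaotic :: "real \<Rightarrow> ((nat \<Rightarrow> complex) \<Rightarrow> (nat \<Rightarrow> complex)) \<Rightarrow> bool" where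
  "chaotic p T \<longleftrightarrow> hypercyclic p T \<and>
     (\<forall>V. lp_open p V \<and> V \<noteq> {} \<longrightarrow> (\<exists>x\<in>V. periodic_point T x))"

definition freq_hypercyclic :: "real \<Rightarrow> ((nat \<Rightarrow> complex) \<Rightarrow> (nat \<Rightarrow> complex)) \<Rightarrow> bool" where
  "freq_hypercyclic p T \<longleftrightarrow> (\<exists>x\<in>lp_space p. \<forall>V. lp_open p V \<and> V \<noteq> {} \<longrightarrow>
      lower_density (return_set T x V) > 0)"

definition freq_hypercyclic_along ::
  "real \<Rightarrow> ((nat \<Rightarrow> complex) \<Rightarrow> (nat \<Rightarrow> complex)) \<Rightarrow> nat set \<Rightarrow> bool" where
  "freq_hypercyclic_along p T A \<longleftrightarrow> (\<exists>x\<in>lp_space p. \<forall>V. lp_open p V \<and> V \<noteq> {} \<longrightarrow>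
      lower_density (A \<inter> return_set T x V) > 0)"

text \<open>Countable families are indexed by \<open>nat\<close> (repetitions allowed, covering finite families).\<close>
definition hereditarily_freq_hypercyclic :: "real \<Rightarrow> ((nat \<Rightarrow> complex) \<Rightarrow> (nat \<Rightarrow> complex)) \<Rightarrow> bool" where
  "hereditarily_freq_hypercyclic p T \<longleftrightarrow>
     (\<forall>V :: nat \<Rightarrow> (nat \<Rightarrow> complex) set. \<forall>A :: nat \<Rightarrow> nat set.
        (\<forall>i. lp_open p (V i) \<and> V i \<noteq> {} \<and> lower_density (A i) > 0) \<longrightarrow>
        (\<exists>x\<in>lp_space p. \<forall>i. lower_density (return_set T x (V i) \<inter> A i) > 0))"

end

theory Submission
  imports Defs "HOL-Library.Nat_Bijection"
begin

text \<open>\<open>T\<close> is a weighted shift on finite blocks of coordinates. At the end of the \<open>n\<close>-th block it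
  sends the mass back to the start of the block with a minus sign, plus a multiple of a vector \<open>y n\<close>
  living on the earlier blocks. The sign makes all finitely supported vectors periodic. The weights
  are such that a tiny multiple \<open>u n\<close> of the first basis vector of the block stays tiny for a
  sixteenth of its period and is then turned into \<open>y n\<close> up to a tiny error. As the \<open>y n\<close> run through a
  dense set, one can steer orbits at will for a fixed proportion of the time, which gives frequent
  hypercyclicity.

  On the other hand, blocks from the \<open>n\<close>-th on do not influence the earlier ones before time \<open>L n\<close>,
  so up to that time the first coordinate of the orbit of any \<open>x\<close> is nearly periodic with period
  \<open>P n\<close>, where \<open>P n\<close> is much smaller than \<open>L n\<close>. There are at most \<open>2 ^ P n\<close> possible visiting
  patterns modulo \<open>P n\<close> to \<open>{|x 0| < 3/2}\<close>. The set \<open>A\<close> is built so that each pattern, or its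
  complement, is avoided by \<open>A\<close> on some long window below \<open>L n\<close>, whichever leaves \<open>A\<close> at least half of
  the integers. Hence along \<open>A\<close> no orbit can visit both \<open>{|x 0| < 1}\<close> and \<open>{|x 0| > 2}\<close> with
  positive lower density.\<close>

section \<open>Sequence spaces\<close>

lemma powr_convex_combination:
  fixes a b p t :: real
  assumes "1 \<le> p" "0 \<le> a" "0 \<le> b" "0 \<le> t" "t \<le> 1"
  shows "((1 - t) * a + t * b) powr p \<le> (1 - t) * a powr p + t * b powr p"
proof -
  have scale: "(u * c) powr p \<le> u * c powr p" if "0 \<le> u" "u \<le> 1" "0 \<le> c" for u c :: real
    using that assms(1) powr_mono'[of 1 p u]
    by (cases "u = 0") (auto simp: powr_mult intro!: mult_right_mono)
  consider "a = 0" | "b = 0" | "0 < a" "0 < b" using assms by linarith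
  then show ?thesis
  proof cases
    case 1
    then show ?thesis using scale[of t b] assms by simp
  next
    case 2
    then show ?thesis using scale[of "1 - t" a] assms by simp
  next
    case 3
    then show ?thesis
      using convex_onD[OF powr_convex[OF assms(1)], of t a b] assms by simp
  qed
qed

text \<open>Stated with bounds \<open>A\<close>, \<open>B\<close> in place of norms, so that it
  applies to partial sums directly. Rescaling by the bounds turns \<open>x + y\<close> into
  \<open>A + B\<close> times a convex combination of \<open>x / A\<close> and \<open>y / B\<close>;
  a zero bound forces the vector itself to vanish.\<close>

lemma finite_Minkowski:
  fixes x y :: "'i \<Rightarrow> 'a::real_normed_vector"
  assumes p: "1 \<le> p" and A: "0 \<le> A" and B: "0 \<le> B"
    and x: "(\<Sum>n\<in>I. norm (x n) powr p) \<le> A powr p"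
    and y: "(\<Sum>n\<in>I. norm (y n) powr p) \<le> B powr p"
  shows "(\<Sum>n\<in>I. norm (x n + y n) powr p) \<le> (A + B) powr p"
proof (cases "finite I")
  case fin: True
  have zero: "\<forall>n\<in>I. z n = 0" if "(\<Sum>n\<in>I. norm (z n) powr p) \<le> 0" for z :: "'i \<Rightarrow> 'a"
  proof -
    have "(\<Sum>n\<in>I. norm (z n) powr p) = 0"
      using that by (intro antisym sum_nonneg) auto
    then show ?thesis using fin p by (simp add: sum_nonneg_eq_0_iff)
  qed
  consider "A = 0" | "B = 0" | "0 < A" "0 < B" using A B by linarith
  then show ?thesis
  proof cases
    case 1
    then have "\<forall>n\<in>I. x n = 0" using x p by (intro zero) simp
    then show ?thesis using y 1 by simp
  next
    case 2
    then have "\<forall>n\<in>I. y n = 0" using y p by (intro zero) simp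
    then show ?thesis using x 2 by simp
  next
    case 3
    define t where "t = B / (A + B)"
    have t: "0 \<le> t" "t \<le> 1" "1 - t = A / (A + B)" using 3 by (auto simp: t_def field_simps)
    have scaled: "(norm z / C) powr p = norm z powr p / C powr p" if "0 < C" for z :: 'a and C
      using that by (simp add: powr_divide)
    have le: "norm (x n + y n) powr p
        \<le> (A + B) powr p * ((1 - t) * (norm (x n) / A) powr p + t * (norm (y n) / B) powr p)" for n
    proof -
      have "norm (x n + y n) \<le> (A + B) * ((1 - t) * (norm (x n) / A) + t * (norm (y n) / B))"
      proof -
        have "(A + B) * ((1 - t) * (norm (x n) / A)) = norm (x n)"
          using 3 unfolding t(3) by simp
        moreover have "(A + B) * (t * (norm (y n) / B)) = norm (y n)"
          using 3 unfolding t_def by simp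
        ultimately show ?thesis
          using norm_triangle_ineq[of "x n" "y n"] by (simp add: distrib_left)
      qed
      then have "norm (x n + y n) powr p
          \<le> ((A + B) * ((1 - t) * (norm (x n) / A) + t * (norm (y n) / B))) powr p"
        using p by (intro powr_mono2) auto
      also have "\<dots> = (A + B) powr p * ((1 - t) * (norm (x n) / A) + t * (norm (y n) / B)) powr p"
        using 3 t by (intro powr_mult)
      also have "\<dots> \<le> (A + B) powr p * ((1 - t) * (norm (x n) / A) powr p + t * (norm (y n) / B) powr p)"
        using 3 t p by (intro mult_left_mono powr_convex_combination) auto
      finally show ?thesis .
    qed
    have "(\<Sum>n\<in>I. norm (x n + y n) powr p)
        \<le> (\<Sum>n\<in>I. (A + B) powr p * ((1 - t) * (norm (x n) / A) powr p + t * (norm (y n) / B) powr p))"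
      by (intro sum_mono le)
    also have "\<dots> = (A + B) powr p * ((1 - t) * ((\<Sum>n\<in>I. norm (x n) powr p) / A powr p)
        + t * ((\<Sum>n\<in>I. norm (y n) powr p) / B powr p))"
      by (simp add: scaled 3 sum_distrib_left sum_divide_distrib sum.distrib distrib_left)
    also have "\<dots> \<le> (A + B) powr p * ((1 - t) * 1 + t * 1)"
      using x y t 3 by (intro mult_left_mono add_mono) (auto simp: divide_le_eq)
    finally show ?thesis by simp
  qed
qed simp

section \<open>Norm estimates by way of partial sums\<close>

lemma lp_norm_nonneg [simp]: "0 \<le> lp_norm p x"
  by (simp add: lp_norm_def)

lemma lp_partial_sum_le:
  assumes "1 \<le> p" "x \<in> lp_space p"
  shows "(\<Sum>n<N. norm (x n) powr p) \<le> lp_norm p x powr p"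
proof -
  have "(\<Sum>n<N. norm (x n) powr p) \<le> (\<Sum>n. norm (x n) powr p)"
    using assms by (intro sum_le_suminf) (auto simp: lp_space_def)
  also have "\<dots> = lp_norm p x powr p"
    using assms suminf_nonneg[of "\<lambda>n. norm (x n) powr p"]
    by (simp add: lp_norm_def powr_powr lp_space_def)
  finally show ?thesis .
qed

lemma lp_boundedI:
  assumes "1 \<le> p" "0 \<le> B" "\<And>N. (\<Sum>n<N. norm (x n) powr p) \<le> B powr p"
  shows "x \<in> lp_space p" "lp_norm p x \<le> B"
proof -
  have sm: "summable (\<lambda>n. norm (x n) powr p)"
    using assms(3) by (intro summableI_nonneg_bounded) auto
  then show "x \<in> lp_space p" by (simp add: lp_space_def)
  have "(\<Sum>n. norm (x n) powr p) \<le> B powr p"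
    using sm assms(3) by (intro suminf_le_const)
  then have "lp_norm p x \<le> (B powr p) powr (1 / p)"
    unfolding lp_norm_def using assms sm by (intro powr_mono2 suminf_nonneg) auto
  then show "lp_norm p x \<le> B" using assms by (simp add: powr_powr)
qed

lemma lp_dominated:
  assumes "1 \<le> p" "x \<in> lp_space p" "\<And>n. norm (z n) \<le> norm (x n)"
  shows "z \<in> lp_space p" "lp_norm p z \<le> lp_norm p x"
proof -
  have "(\<Sum>n<N. norm (z n) powr p) \<le> lp_norm p x powr p" for N
    using assms by (intro order_trans[OF sum_mono lp_partial_sum_le] powr_mono2) auto
  from lp_boundedI[OF assms(1) _ this] show "z \<in> lp_space p" "lp_norm p z \<le> lp_norm p x" by auto
qed

lemma lp_add:
  assumes "1 \<le> p" "x \<in> lp_space p" "y \<in> lp_space p"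
  shows "(\<lambda>n. x n + y n) \<in> lp_space p" "lp_norm p (\<lambda>n. x n + y n) \<le> lp_norm p x + lp_norm p y"
proof -
  have "(\<Sum>n<N. norm (x n + y n) powr p) \<le> (lp_norm p x + lp_norm p y) powr p" for N
    using assms by (intro finite_Minkowski lp_partial_sum_le) auto
  from lp_boundedI[OF assms(1) _ this]
  show "(\<lambda>n. x n + y n) \<in> lp_space p" "lp_norm p (\<lambda>n. x n + y n) \<le> lp_norm p x + lp_norm p y"
    by auto
qed

lemma lp_scale:
  assumes "1 \<le> p" "x \<in> lp_space p"
  shows "(\<lambda>n. c * x n) \<in> lp_space p" "lp_norm p (\<lambda>n. c * x n) \<le> norm c * lp_norm p x"
proof -
  have "(\<Sum>n<N. norm (c * x n) powr p) \<le> (norm c * lp_norm p x) powr p" for N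
  proof -
    have "(\<Sum>n<N. norm (c * x n) powr p) = norm c powr p * (\<Sum>n<N. norm (x n) powr p)"
      by (simp add: norm_mult powr_mult sum_distrib_left)
    also have "\<dots> \<le> norm c powr p * lp_norm p x powr p"
      using assms by (intro mult_left_mono lp_partial_sum_le) auto
    finally show ?thesis by (simp add: powr_mult)
  qed
  from lp_boundedI[OF assms(1) _ this]
  show "(\<lambda>n. c * x n) \<in> lp_space p" "lp_norm p (\<lambda>n. c * x n) \<le> norm c * lp_norm p x" by auto
qed

lemma lp_uminus:
  assumes "1 \<le> p" "x \<in> lp_space p"
  shows "(\<lambda>n. - x n) \<in> lp_space p" "lp_norm p (\<lambda>n. - x n) = lp_norm p x"
proof -
  show *: "(\<lambda>n. - x n) \<in> lp_space p" by (rule lp_dominated(1)[OF assms]) simp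
  show "lp_norm p (\<lambda>n. - x n) = lp_norm p x" by (simp add: lp_norm_def)
qed

lemma lp_diff:
  assumes "1 \<le> p" "x \<in> lp_space p" "y \<in> lp_space p"
  shows "(\<lambda>n. x n - y n) \<in> lp_space p" "lp_norm p (\<lambda>n. x n - y n) \<le> lp_norm p x + lp_norm p y"
  using lp_add[OF assms(1,2) lp_uminus(1)[OF assms(1,3)]] lp_uminus(2)[OF assms(1,3)] by auto

lemma lp_norm_triangle_diff:
  assumes "1 \<le> p" "x \<in> lp_space p" "y \<in> lp_space p" "z \<in> lp_space p"
  shows "lp_norm p (\<lambda>n. x n - z n) \<le> lp_norm p (\<lambda>n. x n - y n) + lp_norm p (\<lambda>n. y n - z n)"
  using lp_add(2)[OF assms(1) lp_diff(1)[OF assms(1-3)] lp_diff(1)[OF assms(1,3,4)]] by simp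

lemma lp_coordinate_le:
  assumes "1 \<le> p" "x \<in> lp_space p"
  shows "norm (x j) \<le> lp_norm p x"
proof -
  have "norm (x j) powr p \<le> (\<Sum>n<Suc j. norm (x n) powr p)"
    by (rule member_le_sum) auto
  also have "\<dots> \<le> lp_norm p x powr p" by (rule lp_partial_sum_le[OF assms])
  finally have "norm (x j) powr p \<le> lp_norm p x powr p" .
  then show ?thesis
    using assms(1) by (meson lp_norm_nonneg norm_ge_zero powr_less_mono2 not_le less_le_trans zero_less_one)
qed

lemma lp_zero:
  assumes "1 \<le> p"
  shows "(\<lambda>_. 0) \<in> lp_space p" "lp_norm p (\<lambda>_. 0) = 0"
  using assms by (auto simp: lp_space_def lp_norm_def)

lemma lp_unit:
  assumes "1 \<le> p"
  shows "(\<lambda>n. if n = j then c else 0) \<in> lp_space p"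
    "lp_norm p (\<lambda>n. if n = j then c else 0) \<le> norm c"
proof -
  have "(\<Sum>n<N. norm (if n = j then c else 0) powr p) \<le> norm c powr p" for N
  proof -
    have "(\<Sum>n<N. norm (if n = j then c else 0) powr p) = (\<Sum>n<N. if n = j then norm c powr p else 0)"
      using assms by (intro sum.cong) auto
    then show ?thesis by (simp add: sum.delta)
  qed
  from lp_boundedI[OF assms _ this]
  show "(\<lambda>n. if n = j then c else 0) \<in> lp_space p"
    "lp_norm p (\<lambda>n. if n = j then c else 0) \<le> norm c" by auto
qed

lemma lp_sum:
  assumes "1 \<le> p" "finite I" "\<And>i. i \<in> I \<Longrightarrow> f i \<in> lp_space p"
  shows "(\<lambda>n. \<Sum>i\<in>I. f i n) \<in> lp_space p \<and>
    lp_norm p (\<lambda>n. \<Sum>i\<in>I. f i n) \<le> (\<Sum>i\<in>I. lp_norm p (f i))"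
  using assms(2,3)
proof (induction I rule: finite_induct)
  case empty
  then show ?case using lp_zero[OF assms(1)] by simp
next
  case (insert i I)
  then show ?case
    using lp_add[OF assms(1), of "f i" "\<lambda>n. \<Sum>i\<in>I. f i n"] by auto
qed

text \<open>A Fatou argument: each partial sum depends continuously on finitely many coordinates, so
  its bound survives pointwise limits.\<close>

lemma lp_pointwise_limit:
  assumes p: "1 \<le> p" and B: "0 \<le> B"
    and f: "\<And>M. f M \<in> lp_space p" "\<And>M. lp_norm p (f M) \<le> B"
    and lim: "\<And>n. (\<lambda>M. f M n) \<longlonglongrightarrow> z n"
  shows "z \<in> lp_space p" "lp_norm p z \<le> B"
proof -
  have "(\<Sum>n<N. norm (z n) powr p) \<le> B powr p" for N
  proof (rule LIMSEQ_le_const2)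
    show "(\<lambda>M. \<Sum>n<N. norm (f M n) powr p) \<longlonglongrightarrow> (\<Sum>n<N. norm (z n) powr p)"
      using p lim by (intro tendsto_sum tendsto_powr' tendsto_norm tendsto_const) auto
    show "\<exists>M0. \<forall>M\<ge>M0. (\<Sum>n<N. norm (f M n) powr p) \<le> B powr p"
      using p f by (intro exI allI impI order_trans[OF lp_partial_sum_le] powr_mono2) auto
  qed
  from lp_boundedI[OF p B this] show "z \<in> lp_space p" "lp_norm p z \<le> B" by auto
qed

text \<open>A substitute for completeness: summable norms make the series converge coordinatewise,
  and the limit inherits the triangle inequality of the partial sums. This is what makes
  \<open>R\<close> well defined and bounded.\<close>

lemma lp_series:
  assumes p: "1 \<le> p" and f: "\<And>m. f m \<in> lp_space p"
    and k: "\<And>m. lp_norm p (f m) \<le> k m" "summable k"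
  shows "summable (\<lambda>m. f m n)"
    "(\<lambda>n. \<Sum>m. f m n) \<in> lp_space p" "lp_norm p (\<lambda>n. \<Sum>m. f m n) \<le> (\<Sum>m. k m)"
proof -
  have k0: "0 \<le> k m" for m using k(1)[of m] order_trans[OF lp_norm_nonneg] by blast
  have sm: "summable (\<lambda>m. f m n)" for n
    using k lp_coordinate_le[OF p f] by (intro summable_comparison_test'[OF k(2), of 0]) (meson order_trans)
  then show "summable (\<lambda>m. f m n)" .
  have bd: "lp_norm p (\<lambda>n. \<Sum>m<M. f m n) \<le> (\<Sum>m. k m)" for M
  proof -
    have "lp_norm p (\<lambda>n. \<Sum>m<M. f m n) \<le> (\<Sum>m<M. lp_norm p (f m))"
      using lp_sum[OF p, of "{..<M}" f] f by auto
    also have "\<dots> \<le> (\<Sum>m<M. k m)" by (intro sum_mono k)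
    also have "\<dots> \<le> (\<Sum>m. k m)" using k k0 by (intro sum_le_suminf) auto
    finally show ?thesis .
  qed
  show "(\<lambda>n. \<Sum>m. f m n) \<in> lp_space p" "lp_norm p (\<lambda>n. \<Sum>m. f m n) \<le> (\<Sum>m. k m)"
    using lp_pointwise_limit[OF p suminf_nonneg[OF k(2) k0] _ bd summable_LIMSEQ[OF sm]]
      lp_sum[OF p, of "{..<M}" f for M] f by auto
qed

section \<open>A countable dense set of finitely supported vectors\<close>

definition gaussian_rat :: "complex set" where
  "gaussian_rat = (\<lambda>(a, b). Complex a b) ` (\<rat> \<times> \<rat>)"

lemma gaussian_rat_simps [simp]:
  "0 \<in> gaussian_rat"
  "x \<in> gaussian_rat \<Longrightarrow> y \<in> gaussian_rat \<Longrightarrow> x + y \<in> gaussian_rat"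
  "x \<in> gaussian_rat \<Longrightarrow> y \<in> gaussian_rat \<Longrightarrow> x - y \<in> gaussian_rat"
proof -
  have iff: "z \<in> gaussian_rat \<longleftrightarrow> Re z \<in> \<rat> \<and> Im z \<in> \<rat>" for z
    by (cases z) (auto simp: gaussian_rat_def image_iff)
  show "0 \<in> gaussian_rat" by (simp add: iff)
  show "x \<in> gaussian_rat \<Longrightarrow> y \<in> gaussian_rat \<Longrightarrow> x + y \<in> gaussian_rat" by (simp add: iff)
  show "x \<in> gaussian_rat \<Longrightarrow> y \<in> gaussian_rat \<Longrightarrow> x - y \<in> gaussian_rat" by (simp add: iff)
qed

lemma of_real_gaussian_rat: "r \<in> \<rat> \<Longrightarrow> complex_of_real r \<in> gaussian_rat"
  by (auto simp: gaussian_rat_def image_iff complex_of_real_def)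

lemma gaussian_rat_dense:
  assumes "0 < e"
  shows "\<exists>d\<in>gaussian_rat. norm (z - d) < e"
proof -
  obtain a where a: "a \<in> \<rat>" "Re z - e / 2 < a" "a < Re z"
    using Rats_dense_in_real[of "Re z - e / 2" "Re z"] assms by auto
  obtain b where b: "b \<in> \<rat>" "Im z - e / 2 < b" "b < Im z"
    using Rats_dense_in_real[of "Im z - e / 2" "Im z"] assms by auto
  have "norm (z - Complex a b) \<le> \<bar>Re z - a\<bar> + \<bar>Im z - b\<bar>"
    using cmod_le[of "z - Complex a b"] by simp
  then have "norm (z - Complex a b) < e" using a b by simp
  then show ?thesis using a b by (auto simp: gaussian_rat_def)
qed

definition finite_gaussian :: "(nat \<Rightarrow> complex) set" where
  "finite_gaussian = {x. range x \<subseteq> gaussian_rat \<and> (\<exists>N. \<forall>j\<ge>N. x j = 0)}"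

lemma countable_finite_gaussian: "countable finite_gaussian"
proof -
  let ?f = "\<lambda>l j. if j < length l then l ! j else (0::complex)"
  have "countable gaussian_rat"
    unfolding gaussian_rat_def by (intro countable_image countable_SIGMA countable_rat)
  then have "countable (?f ` lists gaussian_rat)" by simp
  moreover have "finite_gaussian \<subseteq> ?f ` lists gaussian_rat"
  proof
    fix x assume x: "x \<in> finite_gaussian"
    then obtain N where "\<forall>j\<ge>N. x j = 0" by (auto simp: finite_gaussian_def)
    then have "x = ?f (map x [0..<N])" by auto
    moreover have "map x [0..<N] \<in> lists gaussian_rat"
      using x by (auto simp: finite_gaussian_def range_subsetD)
    ultimately show "x \<in> ?f ` lists gaussian_rat" by blast
  qed
  ultimately show ?thesis by (rule countable_subset[rotated])
qed

lemma finite_gaussian_zero: "(\<lambda>_. 0) \<in> finite_gaussian"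
  by (auto simp: finite_gaussian_def)

lemma finite_gaussian_add:
  assumes "x \<in> finite_gaussian" "y \<in> finite_gaussian"
  shows "(\<lambda>j. x j + y j) \<in> finite_gaussian"
proof -
  obtain M N where "\<forall>j\<ge>M. x j = 0" "\<forall>j\<ge>N. y j = 0" using assms by (auto simp: finite_gaussian_def)
  then have "\<forall>j\<ge>max M N. x j + y j = 0" by simp
  moreover have "range (\<lambda>j. x j + y j) \<subseteq> gaussian_rat"
    using assms by (auto simp: finite_gaussian_def range_subsetD)
  ultimately show ?thesis unfolding finite_gaussian_def by (intro CollectI conjI exI)
qed

lemma finite_gaussian_diff:
  assumes "x \<in> finite_gaussian" "y \<in> finite_gaussian"
  shows "(\<lambda>j. x j - y j) \<in> finite_gaussian"
proof -
  obtain M N where "\<forall>j\<ge>M. x j = 0" "\<forall>j\<ge>N. y j = 0" using assms by (auto simp: finite_gaussian_def)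
  then have "\<forall>j\<ge>max M N. x j - y j = 0" by simp
  moreover have "range (\<lambda>j. x j - y j) \<subseteq> gaussian_rat"
    using assms by (auto simp: finite_gaussian_def range_subsetD)
  ultimately show ?thesis unfolding finite_gaussian_def by (intro CollectI conjI exI)
qed

lemma finite_gaussian_lp:
  assumes "1 \<le> p" "x \<in> finite_gaussian"
  shows "x \<in> lp_space p"
proof -
  obtain N where "\<forall>j\<ge>N. x j = 0" using assms by (auto simp: finite_gaussian_def)
  then show ?thesis
    unfolding lp_space_def mem_Collect_eq using assms(1)
    by (intro summable_finite[of "{..<N}"]) (auto simp: not_less)
qed

lemma finite_gaussian_dense:
  assumes p: "1 \<le> p" and x: "x \<in> lp_space p" and e: "0 < e"
  shows "\<exists>d\<in>finite_gaussian. lp_norm p (\<lambda>n. d n - x n) < e"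
proof -
  \<comment> \<open>The p-th power of \<open>e / 2\<close> is the error budget: one half goes to the
    tail beyond \<open>N\<close>, the other half is shared equally by the \<open>N\<close>
    approximated coordinates.\<close>
  define E where "E = (e / 2) powr p"
  have E: "0 < E" using e by (simp add: E_def)
  have sm: "summable (\<lambda>n. norm (x n) powr p)" using x by (simp add: lp_space_def)
  from suminf_exist_split[OF _ this, of "E / 2"] E obtain N0
    where "\<forall>n\<ge>N0. norm (\<Sum>i. norm (x (i + n)) powr p) < E / 2" by auto
  define N where "N = Suc N0"
  have tail: "(\<Sum>i. norm (x (i + N)) powr p) < E / 2"
    using \<open>\<forall>n\<ge>N0. norm (\<Sum>i. norm (x (i + n)) powr p) < E / 2\<close>[rule_format, of N] by (simp add: N_def)
  define r where "r = (E / (2 * N)) powr (1 / p)"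
  have r: "0 < r" "r powr p = E / (2 * N)" using E p by (auto simp: r_def powr_powr N_def)
  have "\<forall>j. \<exists>d. d \<in> gaussian_rat \<and> norm (x j - d) < r"
    using gaussian_rat_dense[OF r(1)] by blast
  from choice[OF this] obtain d0
    where d0: "\<And>j. d0 j \<in> gaussian_rat" "\<And>j. norm (x j - d0 j) < r" by blast
  define d where "d j = (if j < N then d0 j else 0)" for j
  have "d \<in> finite_gaussian" using d0 by (auto simp: finite_gaussian_def d_def intro!: exI[of _ N])
  have sumd: "(\<Sum>n<M. norm (d n - x n) powr p) \<le> (e / 2) powr p" for M
  proof -
    have "(\<Sum>n<M. norm (d n - x n) powr p) \<le> (\<Sum>n<M + N. norm (d n - x n) powr p)"
      by (rule sum_mono2) auto
    also have "\<dots> = (\<Sum>n<N. norm (d n - x n) powr p) + (\<Sum>n<M. norm (d (n + N) - x (n + N)) powr p)"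
      by (induction M) (auto simp: add_ac)
    also have "(\<Sum>n<N. norm (d n - x n) powr p) \<le> (\<Sum>n<N. E / (2 * N))"
    proof (rule sum_mono)
      fix n assume "n \<in> {..<N}"
      then have "norm (d n - x n) powr p \<le> r powr p"
        using d0(2)[of n] p by (intro powr_mono2) (auto simp: d_def norm_minus_commute)
      then show "norm (d n - x n) powr p \<le> E / (2 * N)" by (simp add: r)
    qed
    also have "(\<Sum>n<N. E / (2 * N)) = E / 2" by (simp add: N_def field_simps)
    also have "(\<Sum>n<M. norm (d (n + N) - x (n + N)) powr p) = (\<Sum>n<M. norm (x (n + N)) powr p)"
      by (simp add: d_def)
    also have "\<dots> \<le> (\<Sum>i. norm (x (i + N)) powr p)"
      using summable_ignore_initial_segment[OF sm, of N] by (intro sum_le_suminf) auto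
    finally show ?thesis using tail by (simp add: E_def)
  qed
  have "lp_norm p (\<lambda>n. d n - x n) \<le> e / 2"
    using sumd e by (intro lp_boundedI(2)[OF p]) auto
  then show ?thesis using \<open>d \<in> finite_gaussian\<close> e by (intro bexI[of _ d]) auto
qed

section \<open>Lower density and periodic sets\<close>

text \<open>Later counts start at 0, whereas \<open>lower_density\<close> counts from 1; they differ
  by at most one element. This and the constant \<open>K\<close> are absorbed by giving up half of
  \<open>c\<close>.\<close>

lemma lower_density_posI:
  assumes c: "0 < c" and le: "\<forall>\<^sub>F N in sequentially. c * real N - K \<le> real (card (A \<inter> {..<N}))"
  shows "0 < lower_density A"
proof -
  have large: "\<forall>\<^sub>F N in sequentially. (K + 1) / (c / 2) \<le> real N"
    by (rule filterlim_at_top[THEN iffD1, rule_format, OF filterlim_real_sequentially])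
  have "\<forall>\<^sub>F N in sequentially. ereal (c / 2) \<le> ereal (real (card (A \<inter> {1..N})) / real N)"
    using le large eventually_gt_at_top[of 0]
  proof eventually_elim
    case (elim N)
    have "A \<inter> {..<N} \<subseteq> insert 0 (A \<inter> {1..N})" by auto
    then have "card (A \<inter> {..<N}) \<le> card (insert 0 (A \<inter> {1..N}))" by (intro card_mono) auto
    also have "\<dots> \<le> Suc (card (A \<inter> {1..N}))" by (rule card_insert_le_m1) auto
    finally have "c * real N - K \<le> real (card (A \<inter> {1..N})) + 1" using elim by linarith
    moreover have "K + 1 \<le> c / 2 * real N" using elim c by (simp add: field_simps)
    ultimately have "c / 2 * real N \<le> real (card (A \<inter> {1..N}))" by (simp add: field_simps)
    then show ?case using elim by (simp add: field_simps)
  qed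
  then have "ereal (c / 2) \<le> lower_density A"
    unfolding lower_density_def by (rule Liminf_bounded)
  moreover have "0 < ereal (c / 2)" using c by simp
  ultimately show ?thesis by (rule less_le_trans[rotated])
qed

text \<open>At \<open>N = (n + 1) * M\<close>, still inside the gap, at most \<open>M\<close>
  elements have been counted, so the quotient is at most \<open>1 / (n + 1)\<close>, and this for
  arbitrarily large \<open>n\<close>.\<close>

lemma lower_density_not_posI:
  assumes gaps: "\<And>n0. \<exists>n\<ge>n0. \<exists>M\<ge>n. 1 \<le> M \<and> A \<inter> {M..<(n + 2) * M} = {}"
  shows "\<not> 0 < lower_density A"
proof
  assume "0 < lower_density A"
  then obtain c where c: "0 < ereal c" "ereal c < lower_density A"
    using ereal_dense2 by blast
  have "\<forall>\<^sub>F N in sequentially. ereal c < ereal (real (card (A \<inter> {1..N})) / real N)"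
    using c(2) unfolding lower_density_def by (rule less_LiminfD)
  then obtain N0 where N0: "\<And>N. N \<ge> N0 \<Longrightarrow> c < real (card (A \<inter> {1..N})) / real N"
    by (auto simp: eventually_sequentially)
  obtain n1 :: nat where n1: "1 / c \<le> real n1" using real_arch_simple by blast
  obtain n M where n: "n \<ge> max N0 n1" and M: "n \<le> M" "1 \<le> M" "A \<inter> {M..<(n + 2) * M} = {}"
    using gaps by blast
  define N where "N = (n + 1) * M"
  have "N \<ge> N0" using n M by (simp add: N_def)
  have "A \<inter> {1..N} \<subseteq> {1..<M}"
  proof
    fix s assume s: "s \<in> A \<inter> {1..N}"
    then have "s < (n + 2) * M" using M by (simp add: N_def)
    then show "s \<in> {1..<M}" using s M(3) by (auto simp: not_le[symmetric])
  qed
  then have "card (A \<inter> {1..N}) \<le> card {1..<M}" by (intro card_mono) auto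
  then have "card (A \<inter> {1..N}) \<le> M" by simp
  then have "real (card (A \<inter> {1..N})) / real N \<le> real M / real N"
    by (intro divide_right_mono) auto
  also have "\<dots> = 1 / (real n + 1)"
  proof -
    have "real N = (real n + 1) * real M" by (simp add: N_def algebra_simps)
    then show ?thesis using M by simp
  qed
  also have "\<dots> \<le> c"
  proof -
    have "1 / c \<le> real n + 1" using n n1 by simp
    then show ?thesis using c(1) by (simp add: field_simps)
  qed
  finally show False using N0[OF \<open>N \<ge> N0\<close>] by simp
qed

lemma periodic_mod:
  fixes Q :: "nat \<Rightarrow> 'a"
  assumes "\<And>s. Q (s + m) = Q s"
  shows "Q (s + k * m) = Q s" "Q (s mod m) = Q s"
proof -
  show *: "Q (s + k * m) = Q s" for s k
    by (induction k) (simp_all add: assms add.assoc[symmetric] add.commute[of m])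
  show "Q (s mod m) = Q s" using *[of "s mod m" "s div m"] by simp
qed

lemma card_periodic:
  assumes "\<And>s. Q (s + m) \<longleftrightarrow> Q s"
  shows "card {s. s < k * m \<and> Q s} = k * card {s. s < m \<and> Q s}"
proof (induction k)
  case (Suc k)
  have "{s. s < Suc k * m \<and> Q s}
      = {s. s < k * m \<and> Q s} \<union> (\<lambda>s. s + k * m) ` {s. s < m \<and> Q s}" (is "_ = ?A \<union> ?B")
  proof (intro set_eqI iffI)
    fix s assume s: "s \<in> {s. s < Suc k * m \<and> Q s}"
    show "s \<in> ?A \<union> ?B"
    proof (cases "s < k * m")
      case False
      then have "s = (s - k * m) + k * m" by simp
      moreover have "s - k * m < m" using s False by auto
      moreover have "Q (s - k * m)"
        using periodic_mod(1)[of Q m "s - k * m" k] assms False s by simp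
      ultimately show ?thesis by blast
    qed (use s in auto)
  next
    fix s assume "s \<in> ?A \<union> ?B"
    then show "s \<in> {s. s < Suc k * m \<and> Q s}" using periodic_mod(1)[of Q m _ k] assms by auto
  qed
  moreover have "?A \<inter> ?B = {}" by auto
  moreover have "card ?B = card {s. s < m \<and> Q s}" by (intro card_image) (auto simp: inj_on_def)
  ultimately show ?case using Suc by (simp add: card_Un_disjoint)
qed simp

lemma strict_mono_bracket:
  fixes f :: "nat \<Rightarrow> nat"
  assumes "strict_mono f" "f 0 \<le> N"
  shows "\<exists>n. f n \<le> N \<and> N < f (Suc n)"
proof -
  have "\<exists>n. N < f n" using strict_mono_imp_increasing[OF assms(1), of "Suc N"] by (auto intro!: exI[of _ "Suc N"])
  then have least: "N < f (LEAST n. N < f n)" by (rule LeastI_ex)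
  define m where "m = (LEAST n. N < f n)"
  have "m \<noteq> 0" using least assms(2) unfolding m_def by (metis not_le)
  then obtain n where n: "m = Suc n" by (cases m) auto
  have "\<not> N < f n" using not_less_Least[of n "\<lambda>n. N < f n"] n by (simp add: m_def)
  then have "f n \<le> N \<and> N < f (Suc n)" using least n by (simp add: m_def)
  then show ?thesis ..
qed

lemma strict_mono_bracket_unique:
  fixes f :: "nat \<Rightarrow> nat"
  assumes "strict_mono f" "f m \<le> N" "N < f (Suc m)" "f n \<le> N" "N < f (Suc n)"
  shows "m = n"
proof -
  have "f m < f (Suc n)" "f n < f (Suc m)" using assms by linarith+
  then show ?thesis using assms(1) by (simp add: strict_mono_less)
qed

section \<open>The block operator\<close>

lemma periodic_funpow:
  assumes "(f ^^ m) x = x"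
  shows "(f ^^ (s + m)) x = (f ^^ s) x" "m dvd k \<Longrightarrow> (f ^^ k) x = x"
proof -
  show "(f ^^ (s + m)) x = (f ^^ s) x" by (simp add: funpow_add assms)
  have "(f ^^ (m * q)) x = x" for q
    by (induction q) (simp_all add: funpow_add assms)
  then show "m dvd k \<Longrightarrow> (f ^^ k) x = x" by (auto elim!: dvdE)
qed

lemma funpow_swap: "(f ^^ m) ((f ^^ k) x) = (f ^^ k) ((f ^^ m) x)"
proof -
  have "(f ^^ (m + k)) x = (f ^^ (k + m)) x" by (simp only: add.commute)
  then show ?thesis by (simp only: funpow_add comp_apply)
qed

definition single :: "nat \<Rightarrow> complex \<Rightarrow> nat \<Rightarrow> complex" where
  "single j c = (\<lambda>i. if i = j then c else 0)"

text \<open>Block \<open>n\<close> consists of the coordinates from \<open>b n\<close> to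
  \<open>b (Suc n) - 1\<close>, and \<open>P n\<close> will be a common period of all vectors
  supported below \<open>b n\<close>. \<open>y_small\<close> keeps the jump out of block
  \<open>n\<close> negligible even after multiplication by \<open>4 ^ L n\<close>, the factor that
  \<open>drift\<close> loses in \<open>L n\<close> steps. \<open>window\<close> leaves room below
  \<open>L n\<close> for one window of ratio \<open>n + 2\<close> per subset of
  \<open>{..<P n}\<close>.\<close>

locale block_operator =
  fixes p :: real and b L P :: "nat \<Rightarrow> nat" and y :: "nat \<Rightarrow> nat \<Rightarrow> complex"
  assumes p: "1 \<le> p"
    and b_0: "b 0 = 0" and b_Suc: "b (Suc n) = b n + 8 * L n"
    and P_0: "P 0 = 1" and P_Suc: "P (Suc n) = 16 * L n" and P_dvd_L: "P n dvd L n"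
    and L_pos: "0 < L n"
    and y_fin: "y n \<in> finite_gaussian"
    and y_supp: "b n \<le> j \<Longrightarrow> y n j = 0"
    and y_dense: "d \<in> finite_gaussian \<Longrightarrow> \<exists>n\<ge>N. y n = d"
    and y_small: "4 ^ L n * ((1/2) ^ (4 * L n) * lp_norm p (y n) + 2 * (1/2) ^ (8 * L n))
      \<le> (1/2) ^ (2 * n + 1)"
    and window: "P n * (n + 2) ^ (2 ^ P n) \<le> L n"
begin

abbreviation lp where "lp \<equiv> lp_space p"
abbreviation nrm where "nrm \<equiv> lp_norm p"

definition last_pos :: "nat \<Rightarrow> nat" where
  "last_pos n = b (Suc n) - 1"

text \<open>The image under \<open>T\<close> of the last basis vector of block \<open>n\<close>. The
  powers of 1/2 are tuned so that \<open>8 * L n\<close> steps turn \<open>u n\<close> into exactly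
  \<open>y n - u n\<close>.\<close>

definition jump :: "nat \<Rightarrow> nat \<Rightarrow> complex" where
  "jump n = (\<lambda>i. (1/2) ^ (4 * L n) * y n i - single (b n) (2 * (1/2) ^ (8 * L n)) i)"

text \<open>The doubled forward shift, cut at the block boundaries. As \<open>b 0 = 0\<close>, the
  truncated difference \<open>0 - 1\<close> never enters.\<close>

definition S :: "(nat \<Rightarrow> complex) \<Rightarrow> nat \<Rightarrow> complex" where
  "S x = (\<lambda>i. if i \<in> range b then 0 else 2 * x (i - 1))"

definition R :: "(nat \<Rightarrow> complex) \<Rightarrow> nat \<Rightarrow> complex" where
  "R x = (\<lambda>i. \<Sum>m. x (last_pos m) * jump m i)"

definition T :: "(nat \<Rightarrow> complex) \<Rightarrow> nat \<Rightarrow> complex" where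
  "T x = (\<lambda>i. S x i + R x i)"

definition E :: "nat \<Rightarrow> (nat \<Rightarrow> complex) set" where
  "E n = {x. \<forall>j\<ge>b n. x j = 0}"

text \<open>The seed of block \<open>n\<close>: small enough to stay tiny under \<open>L n\<close>
  doublings, yet grown to size \<open>2 ^ (4 * L n)\<close> when it reaches the end of the
  block.\<close>

definition u :: "nat \<Rightarrow> nat \<Rightarrow> complex" where
  "u n = single (b n) (2 * (1/2) ^ (4 * L n))"

lemmas lp_simps [simp] = lp_add(1)[OF p] lp_diff(1)[OF p] lp_scale(1)[OF p] lp_zero[OF p]
  finite_gaussian_lp[OF p]

lemma single_lp [simp]: "single j c \<in> lp" and nrm_single: "nrm (single j c) \<le> norm c"
  using lp_unit[OF p, of j c] by (simp_all add: single_def)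

lemma strict_mono_b: "strict_mono b"
  by (rule strict_monoI_Suc) (simp add: b_Suc L_pos)

lemma b_less_iff [simp]: "b m < b n \<longleftrightarrow> m < n" and b_le_iff [simp]: "b m \<le> b n \<longleftrightarrow> m \<le> n"
  and b_eq_iff [simp]: "b m = b n \<longleftrightarrow> m = n"
  using strict_mono_b by (simp_all add: strict_mono_less strict_mono_less_eq strict_mono_eq)

lemma b_ge: "n \<le> b n"
  using strict_mono_b by (rule strict_mono_imp_increasing)

lemma Suc_last_pos: "Suc (last_pos n) = b (Suc n)"
  using L_pos[of n] by (simp add: last_pos_def b_Suc)

lemma last_pos_eq_iff [simp]: "last_pos m = last_pos n \<longleftrightarrow> m = n"
  by (metis Suc_last_pos b_eq_iff nat.inject)

lemma last_pos_less_b: "m < n \<Longrightarrow> last_pos m < b n"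
  by (metis Suc_last_pos Suc_leI b_le_iff less_eq_Suc_le)

lemma b_inside_block:
  assumes "0 < i" "i < 8 * L n"
  shows "b n + i \<notin> range b"
proof
  assume "b n + i \<in> range b"
  then obtain m where m: "b n + i = b m" by auto
  then have "b n < b m" "b m < b (Suc n)" using assms unfolding b_Suc by linarith+
  then show False unfolding b_less_iff by linarith
qed

lemma P_pos: "0 < P n"
  by (cases n) (simp_all add: P_0 P_Suc L_pos)

lemma P_le_L: "P n \<le> L n"
  using P_dvd_L L_pos by (simp add: dvd_imp_le)

lemma P_dvd_Suc: "P n dvd P (Suc n)"
  using P_dvd_L by (simp add: P_Suc)

lemma P_dvd_mono: "m \<le> n \<Longrightarrow> P m dvd P n"
  by (induction n rule: dec_induct) (auto intro: dvd_trans[OF _ P_dvd_Suc])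

lemma L_less_P_Suc: "L n < P (Suc n)"
  using L_pos by (simp add: P_Suc)

lemma strict_mono_P: "strict_mono P"
  using P_le_L L_less_P_Suc by (intro strict_monoI_Suc) (rule le_less_trans)

lemma P_ge: "n \<le> P n"
  using strict_mono_P by (rule strict_mono_imp_increasing)

lemma L_mono: "m \<le> n \<Longrightarrow> L m \<le> L n"
  by (induction n rule: dec_induct)
    (auto intro: order_trans less_imp_le[OF less_le_trans[OF L_less_P_Suc P_le_L]])

section \<open>Boundedness and linearity of the operator\<close>

lemma jump_lp [simp]: "jump n \<in> lp"
  unfolding jump_def by (simp add: y_fin)

lemma nrm_jump: "nrm (jump n) \<le> (1/2) ^ (2 * n + 1) * (1/4) ^ L n"
proof -
  have "nrm (jump n) \<le> nrm (\<lambda>i. (1/2) ^ (4 * L n) * y n i) + nrm (single (b n) (2 * (1/2) ^ (8 * L n)))"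
    unfolding jump_def by (intro lp_diff(2)[OF p]) (auto simp: y_fin)
  also have "\<dots> \<le> (1/2) ^ (4 * L n) * nrm (y n) + 2 * (1/2) ^ (8 * L n)"
    using lp_scale(2)[OF p, of "y n" "(1/2) ^ (4 * L n)"] nrm_single[of "b n" "2 * (1/2) ^ (8 * L n)"]
    by (auto simp: y_fin norm_mult norm_power norm_divide)
  also have "\<dots> \<le> (1/2) ^ (2 * n + 1) * (1/4) ^ L n"
    using y_small[of n] by (simp add: power_divide field_simps)
  finally show ?thesis .
qed

text \<open>Such a vector only sees the jumps with \<open>m >= n\<close>. For these the factor
  \<open>(1/2) ^ (2 * m + 1)\<close> of \<open>nrm_jump\<close> is at most
  \<open>(1/2) ^ Suc m * (1/2) ^ n\<close>: the first part sums to 1, the second is kept as a gain.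
  The case \<open>n = 0\<close> bounds \<open>R\<close> on the whole space.\<close>

lemma R_bound:
  assumes x: "x \<in> lp" "\<And>j. j < b n \<Longrightarrow> x j = 0"
  shows "summable (\<lambda>m. x (last_pos m) * jump m i)"
    "R x \<in> lp" "nrm (R x) \<le> (1/2) ^ n * (1/4) ^ L n * nrm x"
proof -
  let ?k = "\<lambda>m. (1/2) ^ Suc m * ((1/2) ^ n * (1/4) ^ L n * nrm x)"
  have le: "nrm (\<lambda>i. x (last_pos m) * jump m i) \<le> ?k m" for m
  proof (cases "m < n")
    case True
    then have "x (last_pos m) = 0" by (intro x last_pos_less_b)
    then show ?thesis by simp
  next
    case False
    have "nrm (\<lambda>i. x (last_pos m) * jump m i) \<le> norm (x (last_pos m)) * nrm (jump m)"
      by (rule lp_scale(2)[OF p]) simp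
    also have "\<dots> \<le> nrm x * ((1/2) ^ (2 * m + 1) * (1/4) ^ L m)"
      by (intro mult_mono lp_coordinate_le[OF p x(1)] nrm_jump) auto
    also have "\<dots> \<le> nrm x * ((1/2) ^ (Suc m + n) * (1/4) ^ L n)"
      using False by (intro mult_left_mono mult_mono power_decreasing L_mono) auto
    finally show ?thesis by (simp add: power_add mult_ac)
  qed
  have sums: "?k sums ((1/2) ^ n * (1/4) ^ L n * nrm x)"
    using sums_mult2[OF power_half_series] by simp
  note series = lp_series[OF p _ le sums_summable[OF sums]]
  show "summable (\<lambda>m. x (last_pos m) * jump m i)" by (rule series) simp
  show "R x \<in> lp" unfolding R_def by (rule series) simp
  show "nrm (R x) \<le> (1/2) ^ n * (1/4) ^ L n * nrm x"
    unfolding R_def by (subst sums_unique[OF sums]) (rule series, simp)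
qed

lemma S_bound:
  assumes x: "x \<in> lp"
  shows "S x \<in> lp" "nrm (S x) \<le> 2 * nrm x"
proof -
  have "(\<Sum>i<N. norm (S x i) powr p) \<le> (2 * nrm x) powr p" for N
  proof -
    have "(\<Sum>i<Suc N. norm (S x i) powr p) = (\<Sum>i<N. norm (S x (Suc i)) powr p)"
      unfolding sum.lessThan_Suc_shift using rangeI[of b 0] p by (simp add: S_def b_0)
    also have "\<dots> \<le> (\<Sum>i<N. 2 powr p * norm (x i) powr p)"
      by (intro sum_mono) (auto simp: S_def norm_mult powr_mult)
    also have "\<dots> \<le> 2 powr p * nrm x powr p"
      using lp_partial_sum_le[OF p x, of N] by (simp add: sum_distrib_left[symmetric])
    finally have "(\<Sum>i<Suc N. norm (S x i) powr p) \<le> (2 * nrm x) powr p"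
      by (simp add: powr_mult)
    moreover have "(\<Sum>i<N. norm (S x i) powr p) \<le> (\<Sum>i<Suc N. norm (S x i) powr p)" by simp
    ultimately show ?thesis by linarith
  qed
  from lp_boundedI[OF p _ this] show "S x \<in> lp" "nrm (S x) \<le> 2 * nrm x" by auto
qed

lemma T_lp [simp]: "x \<in> lp \<Longrightarrow> T x \<in> lp"
  using S_bound R_bound(2)[of x 0] by (simp add: T_def b_0)

lemma nrm_T:
  assumes "x \<in> lp"
  shows "nrm (T x) \<le> 3 * nrm x"
proof -
  have "nrm (T x) \<le> nrm (S x) + nrm (R x)"
    unfolding T_def using assms R_bound(2)[of x 0] S_bound(1) by (intro lp_add(2)[OF p]) (auto simp: b_0)
  moreover have "nrm (R x) \<le> 1 * nrm x"
  proof -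
    have "(1/4::real) ^ L 0 \<le> 1" by (intro power_le_one) auto
    then have "(1/4) ^ L 0 * nrm x \<le> 1 * nrm x" by (intro mult_right_mono) auto
    then show ?thesis using R_bound(3)[of x 0] assms by (simp add: b_0)
  qed
  ultimately show ?thesis using S_bound(2)[OF assms] by simp
qed

lemma T_add:
  assumes "x \<in> lp" "z \<in> lp"
  shows "T (\<lambda>i. x i + z i) = (\<lambda>i. T x i + T z i)"
proof
  fix i
  have "summable (\<lambda>m. x (last_pos m) * jump m i)" "summable (\<lambda>m. z (last_pos m) * jump m i)"
    using R_bound(1)[of _ 0] assms by (auto simp: b_0)
  then show "T (\<lambda>i. x i + z i) i = T x i + T z i"
    by (simp add: T_def S_def R_def distrib_right distrib_left suminf_add)
qed

lemma T_scale:
  assumes "x \<in> lp"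
  shows "T (\<lambda>i. c * x i) = (\<lambda>i. c * T x i)"
proof
  fix i
  have "summable (\<lambda>m. x (last_pos m) * jump m i)" using R_bound(1)[of _ 0] assms by (auto simp: b_0)
  from suminf_mult[OF this, of c] have "R (\<lambda>i. c * x i) i = c * R x i"
    by (simp only: R_def mult.assoc)
  moreover have "S (\<lambda>i. c * x i) i = c * S x i" by (simp add: S_def)
  ultimately show "T (\<lambda>i. c * x i) i = c * T x i" by (simp only: T_def distrib_left)
qed

lemma lp_operator_T: "lp_operator p T"
  unfolding lp_operator_def using T_add T_scale nrm_T by (intro conjI ballI allI exI[of _ 3]) auto

lemma Tpow_lp [simp]: "x \<in> lp \<Longrightarrow> (T ^^ s) x \<in> lp"
  by (induction s) auto

lemma Tpow_add:
  assumes "x \<in> lp" "z \<in> lp"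
  shows "(T ^^ s) (\<lambda>i. x i + z i) = (\<lambda>i. (T ^^ s) x i + (T ^^ s) z i)"
  using assms by (induction s) (auto simp: T_add)

lemma Tpow_scale:
  assumes "x \<in> lp"
  shows "(T ^^ s) (\<lambda>i. c * x i) = (\<lambda>i. c * (T ^^ s) x i)"
  using assms by (induction s) (auto simp: T_scale)

lemma Tpow_diff:
  assumes "x \<in> lp" "z \<in> lp"
  shows "(T ^^ s) (\<lambda>i. x i - z i) = (\<lambda>i. (T ^^ s) x i - (T ^^ s) z i)"
  using Tpow_add[of x "\<lambda>i. (-1) * z i" s] Tpow_scale[of z s "-1"] assms
    lp_scale(1)[OF p assms(2), of "-1"] by simp

lemma Tpow_zero [simp]: "(T ^^ s) (\<lambda>_. 0) = (\<lambda>_. 0)"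
  using Tpow_scale[of "\<lambda>_. 0" s 0] by simp

lemma Tpow_sum:
  assumes "finite I" "\<And>k. k \<in> I \<Longrightarrow> f k \<in> lp"
  shows "(T ^^ s) (\<lambda>i. \<Sum>k\<in>I. f k i) = (\<lambda>i. \<Sum>k\<in>I. (T ^^ s) (f k) i)"
  using assms
proof (induction I rule: finite_induct)
  case (insert k I)
  then show ?case using Tpow_add[of "f k" "\<lambda>i. \<Sum>k\<in>I. f k i" s] lp_sum[OF p, of I f] by simp
qed simp

section \<open>Orbits of basis vectors and periodicity\<close>

lemma T_single:
  assumes "Suc j \<notin> range b"
  shows "T (single j c) = single (Suc j) (2 * c)"
proof -
  have "last_pos m \<noteq> j" for m using assms Suc_last_pos[of m] by auto
  then have "R (single j c) = (\<lambda>_. 0)" by (auto simp: R_def single_def)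
  moreover have "S (single j c) = single (Suc j) (2 * c)"
  proof
    fix i
    show "S (single j c) i = single (Suc j) (2 * c) i"
      using assms rangeI[of b 0] by (cases i) (auto simp: S_def single_def b_0)
  qed
  ultimately show ?thesis by (simp add: T_def)
qed

lemma T_single_last_pos: "T (single (last_pos n) c) = (\<lambda>i. c * jump n i)"
proof -
  have "S (single (last_pos n) c) i = 0" for i
    using rangeI[of b 0] rangeI[of b "Suc n"]
    by (cases i) (auto simp: S_def single_def b_0 Suc_last_pos)
  moreover have "R (single (last_pos n) c) i = c * jump n i" for i
  proof -
    have "R (single (last_pos n) c) i = (\<Sum>m. if m = n then c * jump n i else 0)"
      unfolding R_def by (intro arg_cong[where f = suminf]) (auto simp: single_def)
    also have "\<dots> = c * jump n i"
      using sums_unique[OF sums_single[of n "\<lambda>_. c * jump n i"]] by simp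
    finally show ?thesis .
  qed
  ultimately show ?thesis by (auto simp: T_def)
qed

lemma Tpow_single:
  assumes "i < 8 * L n"
  shows "(T ^^ i) (single (b n) c) = single (b n + i) (2 ^ i * c)"
  using assms
proof (induction i)
  case (Suc i)
  then have "T (single (b n + i) (2 ^ i * c)) = single (Suc (b n + i)) (2 * (2 ^ i * c))"
    using b_inside_block[of "Suc i" n] by (intro T_single) simp
  then show ?case using Suc by (simp add: mult_ac)
qed simp

lemma u_lp [simp]: "u n \<in> lp"
  by (simp add: u_def)

text \<open>After \<open>8 * L n - 1\<close> doublings all mass sits at the last position of the
  block; the next step replaces it by a multiple of \<open>jump n\<close>, whose coefficients
  compensate the growth. The minus sign in front of \<open>u n\<close> is the source of
  periodicity.\<close>

lemma Tpow_u_return: "(T ^^ (8 * L n)) (u n) = (\<lambda>i. y n i - u n i)"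
proof -
  obtain k where k: "8 * L n = Suc k" using L_pos[of n] by (cases "8 * L n") auto
  have last: "b n + k = last_pos n" using k by (simp add: last_pos_def b_Suc)
  have "(T ^^ Suc k) (u n) = T (single (last_pos n) (2 ^ k * (2 * (1/2) ^ (4 * L n))))"
    using Tpow_single[of k n] k last by (simp add: u_def)
  also have "\<dots> = (\<lambda>i. (2 ^ k * (2 * (1/2) ^ (4 * L n))) * jump n i)" by (rule T_single_last_pos)
  \<comment> \<open>The last of the \<open>8 * L n\<close> steps does not double, so
    \<open>k\<close> is one short; the factor 2 in \<open>u n\<close> makes up for it.\<close>
  also have "2 ^ k * (2 * (1/2) ^ (4 * L n)) = (2::complex) ^ (4 * L n)"
  proof -
    have "2 ^ k * (2 * (1/2) ^ (4 * L n)) = (2::complex) ^ (4 * L n + 4 * L n) * (1/2) ^ (4 * L n)"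
      using k by simp
    also have "\<dots> = 2 ^ (4 * L n)" unfolding power_add by (simp add: power_divide)
    finally show ?thesis .
  qed
  also have "(\<lambda>i. 2 ^ (4 * L n) * jump n i) = (\<lambda>i. y n i - u n i)"
  proof -
    have "(2::complex) ^ (4 * L n) * (1/2) ^ (4 * L n) = 1"
      by (simp add: power_divide)
    moreover have "(2::complex) ^ (4 * L n) * (2 * (1/2) ^ (8 * L n)) = 2 * (1/2) ^ (4 * L n)"
      using power_add[of "1/2::complex" "4 * L n" "4 * L n"] by (simp add: power_divide)
    ultimately show ?thesis
      by (auto simp: jump_def u_def single_def right_diff_distrib mult.assoc[symmetric])
  qed
  finally show ?thesis using k by simp
qed

lemma E_mono: "m \<le> n \<Longrightarrow> E m \<subseteq> E n"
  by (auto simp: E_def intro: order_trans[OF b_le_iff[THEN iffD2]])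

lemma E_lp [simp]: "x \<in> E n \<Longrightarrow> x \<in> lp"
  unfolding lp_space_def mem_Collect_eq using p
  by (intro summable_finite[of "{..<b n}"]) (auto simp: E_def not_less)

lemma y_E: "y n \<in> E n"
  by (simp add: E_def y_supp)

lemma u_E: "u n \<in> E (Suc n)"
  using L_pos[of n] by (auto simp: E_def u_def single_def b_Suc)

lemma E_add: "x \<in> E n \<Longrightarrow> z \<in> E n \<Longrightarrow> (\<lambda>i. x i + z i) \<in> E n"
  by (simp add: E_def)

lemma finite_gaussian_E:
  assumes "x \<in> finite_gaussian"
  shows "\<exists>n. x \<in> E n"
proof -
  obtain N where N: "\<forall>j\<ge>N. x j = 0" using assms by (auto simp: finite_gaussian_def)
  then have "x \<in> E N" using b_ge[of N] by (auto simp: E_def)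
  then show ?thesis ..
qed

lemma E_decomposition: "x \<in> E n \<Longrightarrow> x = (\<lambda>i. \<Sum>j<b n. single j (x j) i)"
  by (auto simp: E_def single_def fun_eq_iff)

text \<open>Induction on the number of blocks. As \<open>P n\<close> divides \<open>8 * L n\<close>,
  the vector \<open>y n\<close> is fixed by \<open>8 * L n\<close> steps, so two rounds through
  block \<open>n\<close> send \<open>u n\<close> to \<open>y n - (y n - u n) = u n\<close>. Each
  basis vector of the block is a multiple of an iterate of \<open>u n\<close> and inherits its
  period.\<close>

lemma E_periodic: "x \<in> E n \<Longrightarrow> (T ^^ P n) x = x"
proof (induction n arbitrary: x)
  case 0
  then have "x = (\<lambda>_. 0)" by (auto simp: E_def b_0)
  then show ?case by simp
next
  case (Suc n)
  have uu: "(T ^^ (16 * L n)) (u n) = u n"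
  proof -
    have "(T ^^ (16 * L n)) (u n) = (T ^^ (8 * L n)) ((T ^^ (8 * L n)) (u n))"
      using funpow_add[of "8 * L n" "8 * L n" T] by simp
    also have "\<dots> = (\<lambda>i. (T ^^ (8 * L n)) (y n) i - (y n i - u n i))"
      unfolding Tpow_u_return using Tpow_diff[of "y n" "u n" "8 * L n"] Tpow_u_return[of n] by (simp add: y_fin)
    also have "(T ^^ (8 * L n)) (y n) = y n"
      using periodic_funpow(2)[OF Suc.IH[OF y_E]] P_dvd_L by simp
    finally show ?thesis by simp
  qed
  have single: "(T ^^ P (Suc n)) (single j c) = single j c" if "j < b (Suc n)" for j c
  proof (cases "j < b n")
    case True
    then have "single j c \<in> E n" by (auto simp: E_def single_def)
    from periodic_funpow(2)[OF Suc.IH[OF this] P_dvd_Suc] show ?thesis .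
  next
    case False
    define i where "i = j - b n"
    have i: "j = b n + i" "i < 8 * L n" using False that by (auto simp: i_def b_Suc)
    define a where "a = c / 2 ^ i / (2 * (1/2) ^ (4 * L n))"
    have eq: "single j c = (T ^^ i) (\<lambda>k. a * u n k)"
    proof -
      have "(\<lambda>k. a * u n k) = single (b n) (c / 2 ^ i)"
        by (auto simp: u_def single_def a_def)
      then show ?thesis using Tpow_single[OF i(2), of "c / 2 ^ i"] i by simp
    qed
    have per: "(T ^^ P (Suc n)) (\<lambda>k. a * u n k) = (\<lambda>k. a * u n k)"
      unfolding P_Suc by (simp only: Tpow_scale[OF u_lp] uu)
    show ?thesis unfolding eq by (subst funpow_swap) (simp only: per)
  qed
  have "(T ^^ P (Suc n)) x = (\<lambda>i. \<Sum>j<b (Suc n). (T ^^ P (Suc n)) (single j (x j)) i)"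
    by (subst E_decomposition[OF Suc.prems], subst Tpow_sum) auto
  also have "\<dots> = (\<lambda>i. \<Sum>j<b (Suc n). single j (x j) i)" using single by simp
  also have "\<dots> = x" by (rule E_decomposition[OF Suc.prems, symmetric])
  finally show ?case .
qed

section \<open>Comparison with the pure shift\<close>

lemma S_vanish: "(\<And>j. j < b n \<Longrightarrow> x j = 0) \<Longrightarrow> i < b n \<Longrightarrow> S x i = 0"
  by (auto simp: S_def)

lemma Spow:
  assumes "x \<in> lp" "\<And>j. j < b n \<Longrightarrow> x j = 0"
  shows "(S ^^ s) x \<in> lp" "nrm ((S ^^ s) x) \<le> 2 ^ s * nrm x" "\<And>j. j < b n \<Longrightarrow> (S ^^ s) x j = 0"
proof (induction s)
  case (Suc s)
  { case 1 show ?case using Suc S_bound(1) by simp }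
  { case 2 show ?case using Suc S_bound(2)[of "(S ^^ s) x"] by simp }
  { case (3 j) then show ?case using S_vanish[of n "(S ^^ s) x" j] Suc by simp }
qed (use assms in auto)

text \<open>A vector supported beyond \<open>b n\<close> interacts with the lower blocks only through the tiny
  vectors \<open>jump m\<close>, \<open>m \<ge> n\<close>, so for a long time it evolves as under \<open>S\<close> alone.\<close>

lemma drift:
  assumes x: "x \<in> lp" "\<And>j. j < b n \<Longrightarrow> x j = 0"
  shows "nrm (\<lambda>i. (T ^^ s) x i - (S ^^ s) x i) \<le> 4 ^ s * ((1/2) ^ n * (1/4) ^ L n * nrm x)"
proof (induction s)
  case (Suc s)
  let ?d = "\<lambda>s i. (T ^^ s) x i - (S ^^ s) x i"
  let ?q = "(1/2) ^ n * (1/4) ^ L n * nrm x"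
  note S = Spow[OF x]
  have "T (\<lambda>i. (T ^^ s) x i - (S ^^ s) x i) = (\<lambda>i. T ((T ^^ s) x) i - T ((S ^^ s) x) i)"
    using Tpow_diff[of _ _ 1] x S(1) by simp
  \<comment> \<open>One step multiplies the old error by at most 3, the bound for \<open>T\<close>,
    and \<open>R\<close> adds at most \<open>2 ^ s * ?q\<close>; hence the rate 4.\<close>
  then have "?d (Suc s) = (\<lambda>i. T (?d s) i + R ((S ^^ s) x) i)"
    by (simp add: T_def fun_eq_iff)
  then have "nrm (?d (Suc s)) \<le> nrm (T (?d s)) + nrm (R ((S ^^ s) x))"
    using lp_add(2)[OF p, of "T (?d s)" "R ((S ^^ s) x)"] S(1) R_bound(2)[OF S(1) S(3)] x by simp
  also have "nrm (T (?d s)) \<le> 3 * nrm (?d s)" using S(1) x by (intro nrm_T) auto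
  also have "\<dots> \<le> 3 * (4 ^ s * ?q)" using Suc by simp
  also have "nrm (R ((S ^^ s) x)) \<le> (1/2) ^ n * (1/4) ^ L n * nrm ((S ^^ s) x)"
    by (rule R_bound(3)[OF S(1) S(3)])
  also have "\<dots> \<le> (1/2) ^ n * (1/4) ^ L n * (2 ^ s * nrm x)" using S(2) by (intro mult_left_mono) auto
  also have "\<dots> = 2 ^ s * ?q" by simp
  also have "\<dots> \<le> 4 ^ s * ?q" by (intro mult_right_mono power_mono) auto
  finally have "nrm (?d (Suc s)) \<le> 3 * (4 ^ s * ?q) + 4 ^ s * ?q" by simp
  also have "\<dots> = 4 ^ Suc s * ?q" by simp
  finally show ?case .
qed simp

text \<open>Up to time \<open>L n\<close> the growth \<open>4 ^ s\<close> is paid for by the factor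
  \<open>(1/4) ^ L n\<close> coming from the jumps. In the second bound the remaining error costs
  one more factor 2.\<close>

lemma drift_window:
  assumes x: "x \<in> lp" "\<And>j. j < b n \<Longrightarrow> x j = 0" and s: "s \<le> L n"
  shows "nrm (\<lambda>i. (T ^^ s) x i - (S ^^ s) x i) \<le> (1/2) ^ n * nrm x"
    "nrm ((T ^^ s) x) \<le> 2 ^ Suc s * nrm x"
proof -
  have "(4::real) ^ s * (1/4) ^ L n \<le> 4 ^ L n * (1/4) ^ L n"
    using s by (intro mult_right_mono power_increasing) auto
  also have "\<dots> = 1" by (simp add: power_divide)
  finally have "(4 ^ s * (1/4) ^ L n) * ((1/2) ^ n * nrm x) \<le> 1 * ((1/2) ^ n * nrm x)"
    by (intro mult_right_mono) auto
  with drift[OF x(1), of n s] x(2) show *: "nrm (\<lambda>i. (T ^^ s) x i - (S ^^ s) x i) \<le> (1/2) ^ n * nrm x"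
    by (simp add: mult_ac)
  have "nrm ((T ^^ s) x) \<le> nrm (\<lambda>i. (T ^^ s) x i - (S ^^ s) x i) + nrm ((S ^^ s) x)"
    using lp_add(2)[OF p, of "\<lambda>i. (T ^^ s) x i - (S ^^ s) x i" "(S ^^ s) x"] Spow(1)[OF x] x by simp
  also have "\<dots> \<le> 2 ^ s * nrm x + 2 ^ s * nrm x"
  proof (intro add_mono Spow(2)[OF x])
    have "(1/2) ^ n * nrm x \<le> 2 ^ s * nrm x"
      by (intro mult_right_mono order_trans[OF power_le_one one_le_power]) auto
    then show "nrm (\<lambda>i. (T ^^ s) x i - (S ^^ s) x i) \<le> 2 ^ s * nrm x" using * by simp
  qed
  finally show "nrm ((T ^^ s) x) \<le> 2 ^ Suc s * nrm x" by (simp add: mult_ac)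
qed

end

section \<open>Frequent hypercyclicity and chaos\<close>

context block_operator
begin

text \<open>A countable family that serves all open sets: each vector of
  \<open>finite_gaussian\<close> is \<open>y q\<close> for arbitrarily large \<open>q\<close>, hence
  the centre of targets of arbitrarily small radius.\<close>

definition target :: "nat \<Rightarrow> (nat \<Rightarrow> complex) set" where
  "target q = {z \<in> lp. nrm (\<lambda>i. z i - y q i) < (1/2) ^ q}"

definition visits :: "(nat \<Rightarrow> complex) \<Rightarrow> nat \<Rightarrow> nat \<Rightarrow> nat" where
  "visits z q m = card {s. s < m \<and> (T ^^ s) z \<in> target q}"

text \<open>A lower bound for the visiting frequency of a periodic vector, read off from one period.
  By \<open>oftenD\<close> the choice of \<open>n\<close> is immaterial, since \<open>P n\<close>
  and \<open>P m\<close> have the common multiple \<open>P (max n m)\<close>.\<close>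

definition often :: "(nat \<Rightarrow> complex) \<Rightarrow> nat \<Rightarrow> real \<Rightarrow> bool" where
  "often z q \<theta> \<longleftrightarrow> (\<exists>n. z \<in> E n \<and> \<theta> * P n \<le> visits z q (P n))"

lemma y_target: "y q \<in> target q"
  using lp_zero(2)[OF p] by (simp add: target_def y_fin)

lemma visits_dvd:
  assumes "z \<in> E n"
  shows "visits z q (k * P n) = k * visits z q (P n)"
  unfolding visits_def
  by (rule card_periodic) (simp add: periodic_funpow(1)[OF E_periodic[OF assms]])

lemma oftenD:
  assumes "often z q \<theta>" "z \<in> E m"
  shows "\<theta> * P m \<le> visits z q (P m)"
proof -
  obtain n where n: "z \<in> E n" "\<theta> * P n \<le> visits z q (P n)" using assms by (auto simp: often_def)
  obtain k l where k: "P (max n m) = k * P n" and l: "P (max n m) = l * P m"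
    using P_dvd_mono[of n "max n m"] P_dvd_mono[of m "max n m"] by (metis dvdE max.cobounded1 max.cobounded2 mult.commute)
  have "0 < l" using l P_pos[of "max n m"] by (cases l) auto
  have "l * (\<theta> * P m) = k * (\<theta> * P n)"
    using arg_cong[OF k[symmetric, unfolded l], of real] by (simp add: mult_ac)
  also have "\<dots> \<le> k * visits z q (P n)" unfolding of_nat_mult using n(2) by (intro mult_left_mono) auto
  also have "k * visits z q (P n) = l * visits z q (P m)"
    using visits_dvd[OF n(1), of q k] visits_dvd[OF assms(2), of q l] k l by simp
  finally show ?thesis using \<open>0 < l\<close> by simp
qed

lemma often_y: "often (y q) q (1 / P q)"
proof -
  have "0 \<in> {s. s < P q \<and> (T ^^ s) (y q) \<in> target q}" using y_target P_pos[of q] by simp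
  then have "0 < visits (y q) q (P q)" unfolding visits_def by (subst card_gt_0_iff) auto
  then show ?thesis unfolding often_def using y_E P_pos[of q] by (intro exI[of _ q]) simp
qed

text \<open>The orbit of \<open>z\<close> is finite, so only finitely many strict inequalities have
  to be preserved, and their least slack serves all \<open>s\<close> and all \<open>q < k\<close> at
  once.\<close>

lemma target_slack:
  assumes z: "z \<in> E n"
  shows "\<exists>e>0. \<forall>s q z'. q < k \<longrightarrow> (T ^^ s) z \<in> target q \<longrightarrow> z' \<in> lp \<longrightarrow>
    nrm (\<lambda>i. z' i - (T ^^ s) z i) < e \<longrightarrow> z' \<in> target q"
proof -
  define I where "I = {(s, q). s < P n \<and> q < k \<and> (T ^^ s) z \<in> target q}"
  define d where "d = (\<lambda>(s, q). (1/2) ^ q - nrm (\<lambda>i. (T ^^ s) z i - y q i))"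
  have "finite ({..<P n} \<times> {..<k})" by simp
  then have fin: "finite I" by (rule finite_subset[rotated]) (auto simp: I_def)
  define e where "e = Min (insert 1 (d ` I))"
  have "0 < e" unfolding e_def using fin by (auto simp: I_def d_def target_def)
  moreover have "z' \<in> target q"
    if q: "q < k" and t: "(T ^^ s) z \<in> target q" and z': "z' \<in> lp" "nrm (\<lambda>i. z' i - (T ^^ s) z i) < e" for s q z'
  proof -
    have per: "(T ^^ (s mod P n)) z = (T ^^ s) z"
      using periodic_funpow(1)[OF E_periodic[OF z]] by (rule periodic_mod(2)[where Q = "\<lambda>s. (T ^^ s) z"])
    then have "(s mod P n, q) \<in> I" using q t P_pos[of n] by (simp add: I_def)
    then have "e \<le> d (s mod P n, q)" unfolding e_def using fin by (intro Min_le) auto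
    then have "nrm (\<lambda>i. z' i - (T ^^ s) z i) + nrm (\<lambda>i. (T ^^ s) z i - y q i) < (1/2) ^ q"
      using z'(2) by (simp add: d_def per)
    moreover have "nrm (\<lambda>i. z' i - y q i)
        \<le> nrm (\<lambda>i. z' i - (T ^^ s) z i) + nrm (\<lambda>i. (T ^^ s) z i - y q i)"
      using z z' y_fin by (intro lp_norm_triangle_diff[OF p]) auto
    ultimately show ?thesis using z' by (simp add: target_def)
  qed
  ultimately show ?thesis by blast
qed

section \<open>Splicing orbits\<close>

lemma L_ge: "n \<le> L n"
  using P_ge[of n] P_le_L[of n] by simp

text \<open>Growth by at most \<open>2 ^ Suc (L n)\<close> leaves
  \<open>8 * (1/2) ^ (3 * L n)\<close>. The constant 4 in the hypothesis covers \<open>u n\<close>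
  as well as the sum of all later seeds in \<open>frequently_visiting_vector\<close>.\<close>

lemma small_for_long:
  assumes r: "r \<in> lp" "\<And>j. j < b n \<Longrightarrow> r j = 0" "nrm r \<le> 4 * (1/2) ^ (4 * L n)" and s: "s \<le> L n"
  shows "nrm ((T ^^ s) r) \<le> 8 * (1/2) ^ n"
proof -
  have "nrm ((T ^^ s) r) \<le> 2 ^ Suc s * nrm r" by (rule drift_window(2)[OF r(1,2) s])
  also have "\<dots> \<le> 2 ^ Suc (L n) * (4 * (1/2) ^ (4 * L n))"
    using r(3) s by (intro mult_mono power_increasing) auto
  also have "\<dots> = 8 * (1/2) ^ (3 * L n)"
  proof -
    have "(1/2::real) ^ (4 * L n) = (1/2) ^ L n * (1/2) ^ (3 * L n)" by (simp flip: power_add)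
    then show ?thesis by (simp add: power_divide)
  qed
  also have "\<dots> \<le> 8 * (1/2) ^ n" using L_ge[of n] by (intro mult_left_mono power_decreasing) auto
  finally show ?thesis .
qed

lemma nrm_u: "nrm (u n) \<le> 2 * (1/2) ^ (4 * L n)"
  using nrm_single[of "b n" "2 * (1/2) ^ (4 * L n)"] by (simp add: u_def norm_mult norm_power norm_divide)

lemma u_vanish: "j < b n \<Longrightarrow> u n j = 0"
  by (simp add: u_def single_def)

lemma Tpow_u_small: "s \<le> L n \<Longrightarrow> nrm ((T ^^ s) (u n)) \<le> 8 * (1/2) ^ n"
proof (rule small_for_long[OF u_lp u_vanish])
  show "nrm (u n) \<le> 4 * (1/2) ^ (4 * L n)"
    using nrm_u[of n] zero_le_power[of "1/2::real" "4 * L n"] by linarith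
qed auto

lemma u_finite_gaussian: "u n \<in> finite_gaussian"
proof -
  have "complex_of_real (2 * (1/2) ^ (4 * L n)) \<in> gaussian_rat"
    by (intro of_real_gaussian_rat Rats_mult Rats_power Rats_divide) auto
  then have "range (u n) \<subseteq> gaussian_rat" by (auto simp: u_def single_def)
  then show ?thesis
    using u_E[of n] by (auto simp: finite_gaussian_def E_def)
qed

lemma eventually_half_power_less:
  assumes "0 < (e::real)"
  shows "\<exists>N. \<forall>n\<ge>N. c * (1/2) ^ n < e"
proof -
  have "(\<lambda>n. c * (1/2) ^ n) \<longlonglongrightarrow> c * 0"
    by (intro tendsto_mult LIMSEQ_power_zero tendsto_const) auto
  then have "\<forall>\<^sub>F n in sequentially. c * (1/2) ^ n < e" using assms by (intro order_tendstoD(2)) auto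
  then show ?thesis by (simp add: eventually_sequentially)
qed

text \<open>If \<open>y n = c - a\<close>, the orbit of \<open>a + u n\<close> follows that of \<open>a\<close> during \<open>[0, L n)\<close> and that
  of \<open>c\<close> during \<open>[8 * L n, 9 * L n)\<close>, each time for a sixteenth of the period \<open>16 * L n\<close>.\<close>

lemma splice_at:
  assumes a: "a \<in> finite_gaussian" and c: "c \<in> finite_gaussian"
  shows "\<exists>N. \<forall>n\<ge>N. y n = (\<lambda>i. c i - a i) \<longrightarrow>
    (\<forall>q<k. \<forall>\<theta>. often a q \<theta> \<or> often c q \<theta> \<longrightarrow> often (\<lambda>i. a i + u n i) q (\<theta> / 16))"
proof -
  obtain n1 n2 where n1: "a \<in> E n1" and n2: "c \<in> E n2" using finite_gaussian_E a c by blast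
  obtain e1 where e1: "0 < e1" "\<And>s q z'. q < k \<Longrightarrow> (T ^^ s) a \<in> target q \<Longrightarrow> z' \<in> lp \<Longrightarrow>
      nrm (\<lambda>i. z' i - (T ^^ s) a i) < e1 \<Longrightarrow> z' \<in> target q"
    using target_slack[OF n1, of k] by blast
  obtain e2 where e2: "0 < e2" "\<And>s q z'. q < k \<Longrightarrow> (T ^^ s) c \<in> target q \<Longrightarrow> z' \<in> lp \<Longrightarrow>
      nrm (\<lambda>i. z' i - (T ^^ s) c i) < e2 \<Longrightarrow> z' \<in> target q"
    using target_slack[OF n2, of k] by blast
  obtain n3 where n3: "\<And>n. n \<ge> n3 \<Longrightarrow> 8 * (1/2) ^ n < min e1 e2"
    using eventually_half_power_less[of "min e1 e2" 8] e1(1) e2(1) by auto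
  show ?thesis
  proof (intro exI[of _ "max (max n1 n2) n3"] allI impI)
    fix n q \<theta>
    assume n: "max (max n1 n2) n3 \<le> n" and yn: "y n = (\<lambda>i. c i - a i)" and q: "q < k"
      and of: "often a q \<theta> \<or> often c q \<theta>"
    have aE: "a \<in> E n" and cE: "c \<in> E n" using n n1 n2 E_mono[of n1 n] E_mono[of n2 n] by auto
    have alp: "a \<in> lp" and clp: "c \<in> lp" using aE cE by simp_all
    define w where "w = (\<lambda>i. a i + u n i)"
    have wE: "w \<in> E (Suc n)"
      unfolding w_def using E_mono[of n "Suc n"] aE u_E[of n] by (intro E_add) auto
    have wlp: "w \<in> lp" using wE by simp
    have small: "nrm ((T ^^ s) (u n)) < e1" "nrm ((T ^^ s) (u n)) < e2" if "s < L n" for s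
      using Tpow_u_small[of s n] n3[of n] n that by auto
    obtain m where m: "L n = m * P n" using P_dvd_L[of n] by (metis dvdE mult.commute)
    have visit_a: "(T ^^ s) w \<in> target q" if s: "s < L n" "(T ^^ s) a \<in> target q" for s
    proof (rule e1(2)[OF q s(2)])
      show "(T ^^ s) w \<in> lp" using wlp by simp
      show "nrm (\<lambda>i. (T ^^ s) w i - (T ^^ s) a i) < e1"
        using small(1)[OF s(1)] Tpow_add[OF alp u_lp, of s n] unfolding w_def by simp
    qed
    \<comment> \<open>At time \<open>8 * L n\<close> the vector \<open>a\<close> has returned to
      itself and \<open>u n\<close> has become \<open>c - a - u n\<close>, so \<open>a\<close>
      cancels and the orbit restarts at \<open>c - u n\<close>.\<close>
    have visit_c: "(T ^^ (s + 8 * L n)) w \<in> target q" if s: "s < L n" "(T ^^ s) c \<in> target q" for s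
    proof (rule e2(2)[OF q s(2)])
      show "(T ^^ (s + 8 * L n)) w \<in> lp" using wlp by simp
      have "P n dvd 8 * L n" using P_dvd_L by simp
      then have "(T ^^ (8 * L n)) a = a" by (rule periodic_funpow(2)[OF E_periodic[OF aE]])
      then have "(T ^^ (8 * L n)) w = (\<lambda>i. c i - u n i)"
        unfolding w_def Tpow_add[OF alp u_lp] Tpow_u_return yn by auto
      then have "(T ^^ (s + 8 * L n)) w = (\<lambda>i. (T ^^ s) c i - (T ^^ s) (u n) i)"
        unfolding funpow_add comp_apply using Tpow_diff[OF clp u_lp, of s n] by simp
      moreover have "nrm (\<lambda>i. (T ^^ s) c i - (T ^^ s) (u n) i - (T ^^ s) c i) = nrm ((T ^^ s) (u n))"
        using lp_uminus(2)[OF p, of "(T ^^ s) (u n)"] by simp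
      ultimately show "nrm (\<lambda>i. (T ^^ (s + 8 * L n)) w i - (T ^^ s) c i) < e2"
        using small(2)[OF s(1)] by simp
    qed
    have fin: "finite {s. s < P (Suc n) \<and> (T ^^ s) w \<in> target q}" by simp
    have "visits a q (L n) \<le> visits w q (P (Suc n))"
      unfolding visits_def using visit_a fin by (intro card_mono) (auto simp: P_Suc)
    then have va: "m * visits a q (P n) \<le> visits w q (P (Suc n))"
      using visits_dvd[OF aE, of q m] m by simp
    have "visits c q (L n) = card ((\<lambda>s. s + 8 * L n) ` {s. s < L n \<and> (T ^^ s) c \<in> target q})"
      unfolding visits_def by (rule card_image[symmetric]) simp
    also have "\<dots> \<le> visits w q (P (Suc n))"
      unfolding visits_def using visit_c fin by (intro card_mono) (auto simp: P_Suc)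
    finally have vc: "m * visits c q (P n) \<le> visits w q (P (Suc n))"
      using visits_dvd[OF cE, of q m] m by simp
    \<comment> \<open>Each stretch of length \<open>L n\<close> consists of \<open>m\<close> full
      periods \<open>P n\<close>, against the period \<open>16 * L n\<close> of \<open>w\<close>;
      this is the loss of 16.\<close>
    have "\<theta> * P n \<le> visits a q (P n) \<or> \<theta> * P n \<le> visits c q (P n)"
      using of oftenD aE cE by blast
    then have "m * (\<theta> * P n) \<le> m * visits a q (P n) \<or> m * (\<theta> * P n) \<le> m * visits c q (P n)"
      unfolding of_nat_mult by (auto intro: mult_left_mono)
    then have "m * (\<theta> * P n) \<le> visits w q (P (Suc n))"
      using va vc by (meson of_nat_mono order_trans)
    then have "\<theta> / 16 * P (Suc n) \<le> visits w q (P (Suc n))" by (simp add: P_Suc m mult_ac)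
    then show "often (\<lambda>i. a i + u n i) q (\<theta> / 16)" using wE unfolding often_def w_def by blast
  qed
qed

text \<open>\<open>y q\<close> visits its own target at least once in \<open>P q\<close> steps, and
  \<open>q + 1\<close> splices cost a factor 16 each. The value does not depend on the number of
  targets treated, so it survives the limit.\<close>

definition rate :: "nat \<Rightarrow> real" where
  "rate q = (1/16) ^ Suc q / P q"

lemma rate_pos: "0 < rate q"
  by (simp add: rate_def P_pos)

text \<open>Backward induction on \<open>j\<close>, splicing \<open>y j\<close> with a vector that
  handles the later targets. Target \<open>q\<close> goes through \<open>q - j + 1\<close> splices,
  however large \<open>k\<close> is.\<close>

lemma multi_target: "\<exists>w\<in>finite_gaussian. \<forall>q<k. often w q (rate q)"
proof -
  have "\<exists>w\<in>finite_gaussian. \<forall>q<k. j \<le> q \<longrightarrow> often w q ((1/16) ^ Suc (q - j) / P q)" if "j \<le> k" for j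
    using that
  proof (induction j rule: inc_induct)
    case base
    show ?case using finite_gaussian_zero by (intro bexI[of _ "\<lambda>_. 0"]) auto
  next
    case (step j)
    then obtain w where w: "w \<in> finite_gaussian"
      "\<And>q. q < k \<Longrightarrow> Suc j \<le> q \<Longrightarrow> often w q ((1/16) ^ Suc (q - Suc j) / P q)" by blast
    from splice_at[OF y_fin w(1), of j k] obtain N where N: "\<forall>n\<ge>N. y n = (\<lambda>i. w i - y j i) \<longrightarrow>
        (\<forall>q<k. \<forall>\<theta>. often (y j) q \<theta> \<or> often w q \<theta> \<longrightarrow> often (\<lambda>i. y j i + u n i) q (\<theta> / 16))" ..
    note N = N[rule_format]
    obtain n where n: "n \<ge> N" "y n = (\<lambda>i. w i - y j i)"
      using y_dense[OF finite_gaussian_diff[OF w(1) y_fin]] by blast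
    have "often (\<lambda>i. y j i + u n i) q ((1/16) ^ Suc (q - j) / P q)" if q: "q < k" "j \<le> q" for q
    proof (cases "q = j")
      case True
      then have "often (y j) q (1 / P q)" using often_y[of j] by simp
      from N[OF n q(1) disjI1[OF this]] show ?thesis using True by (simp add: mult.commute)
    next
      case False
      then have eq: "Suc (q - j) = Suc (Suc (q - Suc j))" and "Suc j \<le> q" using q by auto
      from N[OF n q(1) disjI2[OF w(2)[OF q(1) this(2)]]] show ?thesis
        unfolding eq by (simp add: mult_ac)
    qed
    then show ?case using finite_gaussian_add[OF y_fin u_finite_gaussian] by blast
  qed
  from this[of 0] show ?thesis by (simp add: rate_def)
qed

text \<open>Splicing \<open>x\<close> with a fresh vector from \<open>multi_target\<close> restores
  the full rates up to a single factor 16, so losses do not accumulate from step to step. A large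
  \<open>n\<close> also makes the visits of \<open>x\<close> stable under the perturbations still to
  come.\<close>

lemma freq_step:
  assumes x: "x \<in> finite_gaussian"
  shows "\<exists>n\<ge>N. (\<forall>q<k. often (\<lambda>i. x i + u n i) q (rate q / 16)) \<and>
    (\<forall>s q z. q < k \<longrightarrow> (T ^^ s) x \<in> target q \<longrightarrow> z \<in> lp \<longrightarrow>
      nrm (\<lambda>i. z i - (T ^^ s) x i) \<le> 8 * (1/2) ^ n \<longrightarrow> z \<in> target q)"
proof -
  obtain w where w: "w \<in> finite_gaussian" "\<And>q. q < k \<Longrightarrow> often w q (rate q)" using multi_target by blast
  obtain n0 where n0: "x \<in> E n0" using finite_gaussian_E x by blast
  obtain e where e: "0 < e" "\<And>s q z'. q < k \<Longrightarrow> (T ^^ s) x \<in> target q \<Longrightarrow> z' \<in> lp \<Longrightarrow>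
      nrm (\<lambda>i. z' i - (T ^^ s) x i) < e \<Longrightarrow> z' \<in> target q"
    using target_slack[OF n0, of k] by blast
  obtain N1 where N1: "\<And>n. n \<ge> N1 \<Longrightarrow> 8 * (1/2) ^ n < e"
    using eventually_half_power_less[OF e(1)] by blast
  from splice_at[OF x w(1), of k] obtain N2 where N2: "\<forall>n\<ge>N2. y n = (\<lambda>i. w i - x i) \<longrightarrow>
      (\<forall>q<k. \<forall>\<theta>. often x q \<theta> \<or> often w q \<theta> \<longrightarrow> often (\<lambda>i. x i + u n i) q (\<theta> / 16))" ..
  note N2 = N2[rule_format]
  obtain n where n: "n \<ge> max N (max N1 N2)" "y n = (\<lambda>i. w i - x i)"
    using y_dense[OF finite_gaussian_diff[OF w(1) x]] by blast
  have "z \<in> target q" if "q < k" "(T ^^ s) x \<in> target q" "z \<in> lp"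
    "nrm (\<lambda>i. z i - (T ^^ s) x i) \<le> 8 * (1/2) ^ n" for s q z
    using e(2)[OF that(1-3)] that(4) N1[of n] n(1) by simp
  moreover have "often (\<lambda>i. x i + u n i) q (rate q / 16)" if "q < k" for q
    using N2[OF _ n(2) that disjI2[OF w(2)[OF that]]] n(1) by simp
  ultimately show ?thesis using n(1) by (intro exI[of _ n]) auto
qed

text \<open>Dependent choice on pairs of a vector and the index of the seed to be added next. Stage
  \<open>k\<close> only controls the targets \<open>q < k\<close>, so each step deals with finitely
  many.\<close>

lemma freq_sequence:
  "\<exists>X n. (\<forall>k. X k \<in> E (n k)) \<and> (\<forall>k. n k < n (Suc k)) \<and>
    (\<forall>k. X (Suc k) = (\<lambda>i. X k i + u (n k) i)) \<and>
    (\<forall>k. \<forall>q<k. often (X (Suc k)) q (rate q / 16)) \<and>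
    (\<forall>k s q z. q < k \<longrightarrow> (T ^^ s) (X k) \<in> target q \<longrightarrow> z \<in> lp \<longrightarrow>
      nrm (\<lambda>i. z i - (T ^^ s) (X k) i) \<le> 8 * (1/2) ^ n k \<longrightarrow> z \<in> target q)"
proof -
  define next_ok where "next_ok k x n \<longleftrightarrow> (\<forall>q<k. often (\<lambda>i. x i + u n i) q (rate q / 16)) \<and>
    (\<forall>s q z. q < k \<longrightarrow> (T ^^ s) x \<in> target q \<longrightarrow> z \<in> lp \<longrightarrow>
      nrm (\<lambda>i. z i - (T ^^ s) x i) \<le> 8 * (1/2) ^ n \<longrightarrow> z \<in> target q)" for k x n
  have ex: "\<exists>n\<ge>N. next_ok k x n" if "x \<in> finite_gaussian" for N k x
    using freq_step[OF that] unfolding next_ok_def .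
  let ?A = "\<lambda>k (x, n). x \<in> finite_gaussian \<and> x \<in> E n \<and> next_ok k x n"
  let ?B = "\<lambda>k (x, n) (x', n'). x' = (\<lambda>i. x i + u n i) \<and> n < n'"
  have "\<exists>f. \<forall>k. ?A k (f k) \<and> ?B k (f k) (f (Suc k))"
  proof (rule dependent_nat_choice)
    obtain n where "next_ok 0 (\<lambda>_. 0) n" using ex[OF finite_gaussian_zero] by blast
    then show "\<exists>f. ?A 0 f"
      using finite_gaussian_zero by (intro exI[of _ "(\<lambda>_. 0, n)"]) (simp add: E_def)
  next
    fix f k assume f: "?A k f"
    obtain x n where xn: "f = (x, n)" by (cases f)
    define x' where "x' = (\<lambda>i. x i + u n i)"
    have x': "x' \<in> finite_gaussian" "x' \<in> E (Suc n)"
      using f xn finite_gaussian_add[OF _ u_finite_gaussian] E_add[OF _ u_E] E_mono[of n "Suc n"]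
      by (auto simp: x'_def)
    obtain n' where "n' \<ge> Suc n" "next_ok (Suc k) x' n'" using ex[OF x'(1)] by blast
    then show "\<exists>g. ?A (Suc k) g \<and> ?B k f g"
      using x' E_mono[of "Suc n" n'] xn by (intro exI[of _ "(x', n')"]) (auto simp: x'_def)
  qed
  then obtain f where f: "\<forall>k. ?A k (f k) \<and> ?B k (f k) (f (Suc k))" ..
  define X where "X k = fst (f k)" for k
  define n where "n k = snd (f k)" for k
  have X: "X k \<in> E (n k)" "next_ok k (X k) (n k)" for k
    using f[rule_format, of k] by (simp_all add: X_def n_def split_beta)
  have XS: "X (Suc k) = (\<lambda>i. X k i + u (n k) i)" "n k < n (Suc k)" for k
    using f[rule_format, of k] by (simp_all add: X_def n_def split_beta)
  have X_often: "\<forall>q<k. often (X (Suc k)) q (rate q / 16)" for k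
    using X(2)[of k] unfolding next_ok_def XS(1) by (rule conjunct1)
  note X_slack = X(2)[unfolded next_ok_def, THEN conjunct2]
  show ?thesis
  proof (rule exI[of _ X], rule exI[of _ n], intro conjI)
    show "\<forall>k. X k \<in> E (n k)" by (rule allI) (rule X)
    show "\<forall>k. n k < n (Suc k)" by (rule allI) (rule XS)
    show "\<forall>k. X (Suc k) = (\<lambda>i. X k i + u (n k) i)" by (rule allI) (rule XS)
    show "\<forall>k. \<forall>q<k. often (X (Suc k)) q (rate q / 16)" by (rule allI) (rule X_often)
    show "\<forall>k s q z. q < k \<longrightarrow> (T ^^ s) (X k) \<in> target q \<longrightarrow> z \<in> lp \<longrightarrow>
      nrm (\<lambda>i. z i - (T ^^ s) (X k) i) \<le> 8 * (1/2) ^ n k \<longrightarrow> z \<in> target q"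
      by (rule allI) (rule X_slack)
  qed
qed

text \<open>The vector is the limit of the \<open>X k\<close>. Up to time
  \<open>L (n (Suc k))\<close> it visits the first \<open>Suc k\<close> targets whenever
  \<open>X (Suc k)\<close> does, and the latter is periodic. For \<open>N\<close> between two
  consecutive periods, it suffices to count the full periods of \<open>X (Suc k)\<close> that fit
  below both \<open>N\<close> and \<open>L (n (Suc k))\<close>.\<close>

lemma frequently_visiting_vector:
  "\<exists>x\<in>lp. \<forall>q. \<exists>c>0. \<forall>\<^sub>F N in sequentially. c * real N \<le> real (card (return_set T x (target q) \<inter> {..<N}))"
proof -
  obtain X n where XE: "\<forall>k. X k \<in> E (n k)" and n_less: "\<forall>k. n k < n (Suc k)"
    and XS: "\<forall>k. X (Suc k) = (\<lambda>i. X k i + u (n k) i)"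
    and X_often: "\<forall>k. \<forall>q<k. often (X (Suc k)) q (rate q / 16)"
    and X_slack: "\<forall>k s q z. q < k \<longrightarrow> (T ^^ s) (X k) \<in> target q \<longrightarrow> z \<in> lp \<longrightarrow>
      nrm (\<lambda>i. z i - (T ^^ s) (X k) i) \<le> 8 * (1/2) ^ n k \<longrightarrow> z \<in> target q"
    using freq_sequence by (elim exE conjE) (rule that)
  note XE = XE[rule_format] and n_less = n_less[rule_format] and XS = XS[rule_format]
    and X_often = X_often[rule_format] and X_slack = X_slack[rule_format]
  have Xlp: "X k \<in> lp" for k using XE[of k] by simp
  have n_mono: "strict_mono n" using n_less by (rule strict_monoI_Suc)
  have stable: "X (k + m) j = X k j" if "j < b (n k)" for k m j
  proof (induction m)
    case (Suc m)
    have "n k \<le> n (k + m)" using n_mono by (simp add: strict_mono_less_eq)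
    then have "j < b (n (k + m))" using that b_le_iff[of "n k" "n (k + m)"] by linarith
    then show ?case using Suc by (simp add: XS u_vanish)
  qed simp
  \<comment> \<open>The seeds shrink so fast that the next tail,
    \<open>4 * (1/2) ^ (4 * L (n (Suc k)))\<close>, is at most
    \<open>2 * (1/2) ^ (4 * L (n k))\<close>; adding \<open>nrm_u\<close> reproduces the constant
    4.\<close>
  have close: "nrm (\<lambda>i. X (k + m) i - X k i) \<le> 4 * (1/2) ^ (4 * L (n k))" for k m
  proof (induction m arbitrary: k)
    case 0
    show ?case using lp_zero(2)[OF p] by simp
  next
    case (Suc m)
    have "L (n k) < L (n (Suc k))"
      using n_less[of k] L_less_P_Suc[of "n k"] P_le_L[of "Suc (n k)"] L_mono[of "Suc (n k)" "n (Suc k)"]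
      by linarith
    have "(\<lambda>i. X (k + Suc m) i - X k i) = (\<lambda>i. (X (Suc k + m) i - X (Suc k) i) + u (n k) i)"
      by (simp add: XS[of k])
    then have "nrm (\<lambda>i. X (k + Suc m) i - X k i) \<le> nrm (\<lambda>i. X (Suc k + m) i - X (Suc k) i) + nrm (u (n k))"
      using lp_add(2)[OF p lp_diff(1)[OF p Xlp Xlp] u_lp] by metis
    also have "\<dots> \<le> 4 * (1/2) ^ (4 * L (n (Suc k))) + 2 * (1/2) ^ (4 * L (n k))"
      by (intro add_mono Suc nrm_u)
    also have "(1/2::real) ^ (4 * L (n (Suc k))) \<le> (1/2) ^ (4 * L (n k) + 1)"
      using \<open>L (n k) < L (n (Suc k))\<close> by (intro power_decreasing) auto
    finally show ?case by simp
  qed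
  \<comment> \<open>Coordinate \<open>j\<close> lies below \<open>b (n (Suc j))\<close> and is
    frozen from stage \<open>Suc j\<close> on.\<close>
  define x where "x j = X (Suc j) j" for j
  have n_ge: "k \<le> n k" for k using n_mono by (rule strict_mono_imp_increasing)
  have lim: "(\<lambda>m. X (k + m) j) \<longlonglongrightarrow> x j" for k j
  proof (rule tendsto_eventually, unfold eventually_sequentially, intro exI allI impI)
    fix m assume m: "Suc j \<le> m"
    have "j < b (n (Suc j))" using b_ge[of "n (Suc j)"] n_ge[of "Suc j"] by linarith
    from stable[OF this, of "k + m - Suc j"] m show "X (k + m) j = x j" by (simp add: x_def)
  qed
  have rlim: "(\<lambda>m. X (k + m) j - X k j) \<longlonglongrightarrow> x j - X k j" for k j
    by (intro tendsto_diff lim tendsto_const)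
  have r: "(\<lambda>i. x i - X k i) \<in> lp" "nrm (\<lambda>i. x i - X k i) \<le> 4 * (1/2) ^ (4 * L (n k))" for k
    using lp_pointwise_limit[OF p _ lp_diff(1)[OF p Xlp Xlp] close rlim] by auto
  have r0: "x j - X k j = 0" if "j < b (n k)" for k j
    using LIMSEQ_unique[OF lim[of k j]] stable[OF that] by simp
  have xlp: "x \<in> lp" using lp_add(1)[OF p r(1)[of 0] Xlp[of 0]] by simp
  have track: "(T ^^ s) x \<in> target q" if "q < k" "s \<le> L (n k)" "(T ^^ s) (X k) \<in> target q" for s q k
  proof (rule X_slack[OF that(1,3)])
    show "(T ^^ s) x \<in> lp" using xlp by simp
    have "nrm ((T ^^ s) (\<lambda>i. x i - X k i)) \<le> 8 * (1/2) ^ n k"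
      by (rule small_for_long[OF r(1) r0 r(2) that(2)])
    then show "nrm (\<lambda>i. (T ^^ s) x i - (T ^^ s) (X k) i) \<le> 8 * (1/2) ^ n k"
      using Tpow_diff[OF xlp Xlp, of s k] by simp
  qed
  show ?thesis
  proof (intro bexI[OF _ xlp] allI)
    fix q
    define period where "period k = P (Suc (n k))" for k
    have period_mono: "strict_mono period"
      unfolding period_def using n_less strict_mono_P by (intro strict_monoI_Suc) (simp add: strict_mono_less)
    \<comment> \<open>\<open>512 = 16 * 16 * 2\<close>: the loss in \<open>freq_step\<close>,
      another 16 as \<open>X (Suc k)\<close> is followed only for a sixteenth of
      \<open>period (Suc k)\<close>, and 2 for an incomplete last period.\<close>
    define c where "c = rate q / 512"
    have "c * real N \<le> real (card (return_set T x (target q) \<inter> {..<N}))" if N: "N \<ge> period (Suc q)" for N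
    proof -
      have "period 0 \<le> N" using N strict_mono_less_eq[OF period_mono, of 0 "Suc q"] by simp
      then obtain k where k: "period k \<le> N" "N < period (Suc k)"
        using strict_mono_bracket[OF period_mono] by blast
      have "Suc q < Suc k" using N k(2) strict_mono_less[OF period_mono, of "Suc q" "Suc k"] by linarith
      then have qk: "q < k" by simp
      let ?n = "n (Suc k)"
      have XkE: "X (Suc k) \<in> E (Suc (n k))"
        unfolding XS using XE[of k] E_mono[of "n k" "Suc (n k)"] u_E by (intro E_add) auto
      have "period k dvd P ?n" unfolding period_def using n_less[of k] by (intro P_dvd_mono) simp
      then have "period k dvd L ?n" using P_dvd_L dvd_trans by blast
      then have pL: "period k \<le> L ?n" using L_pos dvd_imp_le by blast
      define M where "M = min N (L ?n)"
      define f where "f = M div period k"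
      have ppos: "0 < period k" by (simp add: period_def P_pos)
      have "N \<le> 16 * M" using k(2) by (auto simp: M_def period_def P_Suc)
      moreover have "M < f * period k + period k"
        using mod_less_divisor[OF ppos, of M] div_mult_mod_eq[of M "period k"] unfolding f_def by linarith
      moreover have "period k \<le> f * period k"
      proof -
        have "period k \<le> M" using k(1) pL by (simp add: M_def)
        then have "1 \<le> f" using ppos by (simp add: f_def Suc_le_eq div_greater_zero_iff)
        then show ?thesis by simp
      qed
      ultimately have "N \<le> 32 * (f * period k)" by linarith
      then have "real N \<le> real (32 * (f * period k))" by (rule of_nat_mono)
      then have "c * N \<le> c * real (32 * (f * period k))"
        using rate_pos[of q] by (intro mult_left_mono) (simp_all add: c_def)
      also have "\<dots> = f * (rate q / 16 * period k)" by (simp add: c_def)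
      also have "\<dots> \<le> f * real (visits (X (Suc k)) q (period k))"
        using oftenD[OF X_often[OF qk] XkE] by (intro mult_left_mono) (auto simp: period_def)
      also have "\<dots> = real (visits (X (Suc k)) q (f * period k))"
        using visits_dvd[OF XkE, of q f] by (simp add: period_def)
      also have "visits (X (Suc k)) q (f * period k) \<le> card (return_set T x (target q) \<inter> {..<N})"
        unfolding visits_def
      proof (intro card_mono subsetI)
        fix s assume s: "s \<in> {s. s < f * period k \<and> (T ^^ s) (X (Suc k)) \<in> target q}"
        have "f * period k \<le> M" by (simp add: f_def)
        then have "s < N" "s \<le> L ?n" using s by (auto simp: M_def)
        then show "s \<in> return_set T x (target q) \<inter> {..<N}"
          using track[of q "Suc k" s] qk s by (simp add: return_set_def)
      qed simp
      finally show ?thesis by simp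
    qed
    moreover have "0 < c" using rate_pos by (simp add: c_def)
    ultimately show "\<exists>c>0. \<forall>\<^sub>F N in sequentially.
        c * real N \<le> real (card (return_set T x (target q) \<inter> {..<N}))"
      unfolding eventually_sequentially by blast
  qed
qed

lemma target_in_open:
  assumes V: "lp_open p V" "V \<noteq> {}"
  shows "\<exists>q. target q \<subseteq> V"
proof -
  obtain v where v: "v \<in> V" using V by blast
  then have vlp: "v \<in> lp" using V by (auto simp: lp_open_def)
  obtain e where e: "0 < e" "\<And>z. z \<in> lp \<Longrightarrow> nrm (\<lambda>n. z n - v n) < e \<Longrightarrow> z \<in> V"
    using V v unfolding lp_open_def by blast
  obtain d where d: "d \<in> finite_gaussian" "nrm (\<lambda>n. d n - v n) < e / 2"
    using finite_gaussian_dense[OF p vlp, of "e / 2"] e by auto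
  obtain N where N: "\<And>n. n \<ge> N \<Longrightarrow> 1 * (1/2) ^ n < e / 2"
    using eventually_half_power_less[of "e / 2" 1] e by auto
  \<comment> \<open>As \<open>d\<close> recurs in the sequence \<open>y\<close>, the index
    \<open>q\<close> can be taken so large that the radius \<open>(1/2) ^ q\<close> is below
    \<open>e / 2\<close>.\<close>
  obtain q where q: "q \<ge> N" "y q = d" using y_dense[OF d(1)] by blast
  have "z \<in> V" if z: "z \<in> target q" for z
  proof (rule e(2))
    show "z \<in> lp" using z by (simp add: target_def)
    have "nrm (\<lambda>n. z n - v n) \<le> nrm (\<lambda>n. z n - d n) + nrm (\<lambda>n. d n - v n)"
      using z d vlp by (intro lp_norm_triangle_diff[OF p]) (auto simp: target_def)
    then show "nrm (\<lambda>n. z n - v n) < e" using z d N[OF q(1)] q by (simp add: target_def)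
  qed
  then show ?thesis by blast
qed

lemma freq_hypercyclic_T: "freq_hypercyclic p T"
proof -
  obtain x where x: "x \<in> lp" "\<And>q. \<exists>c>0. \<forall>\<^sub>F N in sequentially.
      c * real N \<le> real (card (return_set T x (target q) \<inter> {..<N}))"
    using frequently_visiting_vector by blast
  have "0 < lower_density (return_set T x V)" if V: "lp_open p V" "V \<noteq> {}" for V
  proof -
    obtain q where q: "target q \<subseteq> V" using target_in_open[OF V] by blast
    obtain c where c: "0 < c" "\<forall>\<^sub>F N in sequentially.
        c * real N \<le> real (card (return_set T x (target q) \<inter> {..<N}))" using x(2) by blast
    show ?thesis
    proof (rule lower_density_posI[OF c(1), of 0])
      show "\<forall>\<^sub>F N in sequentially. c * real N - 0 \<le> real (card (return_set T x V \<inter> {..<N}))"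
        using c(2)
      proof eventually_elim
        case (elim N)
        have "card (return_set T x (target q) \<inter> {..<N}) \<le> card (return_set T x V \<inter> {..<N})"
          using q by (intro card_mono) (auto simp: return_set_def)
        then show ?case using elim by simp
      qed
    qed
  qed
  then show ?thesis using x(1) by (auto simp: freq_hypercyclic_def)
qed

lemma chaotic_T: "chaotic p T"
  unfolding chaotic_def
proof (intro conjI allI impI)
  have "\<not> 0 < lower_density {}" by (simp add: lower_density_def Liminf_const)
  then show "hypercyclic p T"
    using freq_hypercyclic_T unfolding freq_hypercyclic_def hypercyclic_def by metis
  fix V assume "lp_open p V \<and> V \<noteq> {}"
  then obtain q where "target q \<subseteq> V" using target_in_open by blast
  moreover have "periodic_point T (y q)"
    unfolding periodic_point_def using E_periodic[OF y_E] P_pos by blast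
  ultimately show "\<exists>x\<in>V. periodic_point T x" using y_target by blast
qed

end

section \<open>The thinned set\<close>

lemma set_decode_subset:
  assumes "c < 2 ^ m"
  shows "set_decode c \<subseteq> {..<m}"
proof
  fix i assume "i \<in> set_decode c"
  then have "c div 2 ^ i \<noteq> 0" by (auto simp: set_decode_def intro: ccontr)
  then have "2 ^ i \<le> c" by (simp add: div_eq_0_iff not_less)
  then have "(2::nat) ^ i < 2 ^ m" using assms by (rule le_less_trans)
  then show "i \<in> {..<m}" by simp
qed

lemma set_encode_less:
  assumes "G \<subseteq> {..<m}"
  shows "set_encode G < 2 ^ m"
proof -
  have "set_encode G \<le> (\<Sum>i<m. 2 ^ i)"
    unfolding set_encode_def using assms by (intro sum_mono2) auto
  also have "\<dots> < 2 ^ m" by (induction m) auto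
  finally show ?thesis .
qed

context block_operator
begin

text \<open>Every subset of \<open>{..<P n}\<close> containing at least half of the residues gets a long window,
  below the time \<open>L n\<close>, in which only these residues are allowed.\<close>

definition thinned :: "nat set" where
  "thinned = {s. \<forall>n c. c < 2 ^ P n \<longrightarrow> P n \<le> 2 * card (set_decode c) \<longrightarrow>
     P n * (n + 2) ^ c \<le> s \<longrightarrow> s < P n * (n + 2) ^ (c + 1) \<longrightarrow> s mod P n \<in> set_decode c}"

text \<open>Hence the windows of level \<open>n\<close> lie between \<open>P n\<close> and
  \<open>L n < P (Suc n)\<close>, and windows of different levels are disjoint.\<close>

lemma window_le: "c < 2 ^ P n \<Longrightarrow> P n * (n + 2) ^ (c + 1) \<le> L n"
  by (rule order_trans[OF _ window]) (intro mult_left_mono power_increasing, auto)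

text \<open>The ends of the windows of level \<open>n\<close> are multiples of \<open>P n\<close>,
  so a chunk lies inside such a window or misses it; by disjointness at most one window is relevant.
  Inside it at least half of the residues are allowed, outside all of them.\<close>

lemma card_thinned_chunk:
  assumes k: "1 \<le> k" "(k + 1) * P n \<le> P (Suc n)"
  shows "P n \<le> 2 * card (thinned \<inter> {k * P n..<(k + 1) * P n})"
proof -
  define C where "C c \<longleftrightarrow> c < 2 ^ P n \<and> P n \<le> 2 * card (set_decode c) \<and>
    (n + 2) ^ c \<le> k \<and> k < (n + 2) ^ (c + 1)" for c
  have mono: "strict_mono (\<lambda>c. (n + 2) ^ c)" by (intro strict_monoI_Suc) simp
  have uniq: "c = c'" if "C c" "C c'" for c c'
    using strict_mono_bracket_unique[OF mono, of c k c'] that by (simp add: C_def)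
  define F where "F = {r. r < P n \<and> (\<forall>c. C c \<longrightarrow> r \<in> set_decode c)}"
  have "P n \<le> 2 * card F"
  proof (cases "\<exists>c. C c")
    case True
    then obtain c where c: "C c" by blast
    have "set_decode c \<subseteq> {..<P n}" using c by (intro set_decode_subset) (simp add: C_def)
    moreover have "r \<in> set_decode c'" if "r \<in> set_decode c" "C c'" for r c'
      using uniq[OF c that(2)] that(1) by simp
    ultimately have "set_decode c \<subseteq> F" unfolding F_def by blast
    then have "card (set_decode c) \<le> card F" by (intro card_mono) (auto simp: F_def)
    then show ?thesis using c by (simp add: C_def)
  next
    case False
    then have "F = {..<P n}" by (auto simp: F_def)
    then show ?thesis by simp
  qed
  also have "card F = card ((\<lambda>r. k * P n + r) ` F)" by (rule card_image[symmetric]) simp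
  also have "\<dots> \<le> card (thinned \<inter> {k * P n..<(k + 1) * P n})"
  proof (intro card_mono subsetI IntI)
    fix s assume "s \<in> (\<lambda>r. k * P n + r) ` F"
    then obtain r where s: "s = k * P n + r" and r: "r < P n" "\<And>c. C c \<Longrightarrow> r \<in> set_decode c"
      by (auto simp: F_def)
    show sk: "s \<in> {k * P n..<(k + 1) * P n}" using s r by simp
    show "s \<in> thinned"
      unfolding thinned_def mem_Collect_eq
    proof (intro allI impI)
      fix n' c assume c: "c < 2 ^ P n'" "P n' \<le> 2 * card (set_decode c)"
        "P n' * (n' + 2) ^ c \<le> s" "s < P n' * (n' + 2) ^ (c + 1)"
      have "P n' * 1 \<le> P n' * (n' + 2) ^ c" by (intro mult_left_mono) auto
      then have "P n' \<le> s" using c(3) by linarith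
      moreover have "s < P (Suc n')" using c(4) window_le[OF c(1)] L_less_P_Suc[of n'] by linarith
      moreover have "1 * P n \<le> k * P n" using k by (intro mult_right_mono) auto
      then have "P n \<le> s" "s < P (Suc n)" using sk k(2) unfolding atLeastLessThan_iff by linarith+
      ultimately have n': "n' = n" by (intro strict_mono_bracket_unique[OF strict_mono_P])
      have "P n * (n + 2) ^ c < P n * (k + 1)" "P n * k < P n * (n + 2) ^ (c + 1)"
        using c(3,4) sk unfolding n' atLeastLessThan_iff mult.commute[of "P n"] by linarith+
      then have "C c" using c P_pos[of n] unfolding n' C_def by (simp only: mult_less_cancel1) simp
      then show "s mod P n' \<in> set_decode c" using r s n' by simp
    qed
  qed simp
  finally show ?thesis by simp
qed

text \<open>Chunks are added up level by level, level \<open>Suc n\<close> starting at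
  \<open>P (Suc n)\<close>, where level \<open>n\<close> ends. The \<open>+ 1\<close> pays for the
  initial chunk \<open>{0}\<close>, to which \<open>card_thinned_chunk\<close> does not
  apply.\<close>

lemma card_thinned:
  "1 \<le> k \<Longrightarrow> k * P n \<le> P (Suc n) \<Longrightarrow> k * P n \<le> 2 * card (thinned \<inter> {..<k * P n}) + 1"
proof (induction n arbitrary: k)
  case base: 0
  from base show ?case
  proof (induction k rule: dec_induct)
    case (step k)
    have "card (thinned \<inter> {..<Suc k * P 0})
        = card (thinned \<inter> {..<k * P 0} \<union> thinned \<inter> {k * P 0..<(k + 1) * P 0})"
      by (intro arg_cong[where f = card]) auto
    also have "\<dots> = card (thinned \<inter> {..<k * P 0}) + card (thinned \<inter> {k * P 0..<(k + 1) * P 0})"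
      by (intro card_Un_disjoint) auto
    finally show ?case using step card_thinned_chunk[of k 0] by simp
  qed (simp add: P_0)
next
  case (Suc n)
  from Suc.prems show ?case
  proof (induction k rule: dec_induct)
    case base
    obtain q where q: "P (Suc n) = q * P n" using P_dvd_Suc[of n] by (metis dvdE mult.commute)
    then show ?case using Suc.IH[of q] P_pos[of "Suc n"] by (cases q) auto
  next
    case (step k)
    have "card (thinned \<inter> {..<Suc k * P (Suc n)})
        = card (thinned \<inter> {..<k * P (Suc n)} \<union> thinned \<inter> {k * P (Suc n)..<(k + 1) * P (Suc n)})"
      by (intro arg_cong[where f = card]) auto
    also have "\<dots> = card (thinned \<inter> {..<k * P (Suc n)})
        + card (thinned \<inter> {k * P (Suc n)..<(k + 1) * P (Suc n)})"
      by (intro card_Un_disjoint) auto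
    finally show ?case using step card_thinned_chunk[of k "Suc n"] by simp
  qed
qed

lemma lower_density_thinned: "0 < lower_density thinned"
\<comment> \<open>Rounding \<open>N\<close> down to a multiple of \<open>P n\<close> loses a factor
  2 and thinning another one; the \<open>1/2\<close> below stems from the \<open>+ 1\<close> in
  \<open>card_thinned\<close>.\<close>
proof (rule lower_density_posI[of "1/4"])
  show "\<forall>\<^sub>F N in sequentially. 1/4 * real N - 1/2 \<le> real (card (thinned \<inter> {..<N}))"
    using eventually_ge_at_top[of 1]
  proof eventually_elim
    case (elim N)
    then obtain n where n: "P n \<le> N" "N < P (Suc n)"
      using strict_mono_bracket[OF strict_mono_P, of N] by (auto simp: P_0)
    define k where "k = N div P n"
    have k: "1 \<le> k" using n P_pos[of n] by (simp add: k_def Suc_le_eq div_greater_zero_iff)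
    have le: "k * P n \<le> N" by (simp add: k_def)
    have "N < k * P n + P n"
      using mod_less_divisor[OF P_pos, of N n] div_mult_mod_eq[of N "P n"] unfolding k_def by linarith
    moreover have "1 * P n \<le> k * P n" using k by (intro mult_right_mono) auto
    ultimately have "N < 2 * (k * P n)" by linarith
    also have "k * P n \<le> 2 * card (thinned \<inter> {..<k * P n}) + 1"
      using card_thinned[OF k] le n by simp
    also have "card (thinned \<inter> {..<k * P n}) \<le> card (thinned \<inter> {..<N})"
      using le by (intro card_mono) auto
    finally show ?case by simp
  qed
qed simp

text \<open>The code of \<open>G\<close> selects a window from \<open>M\<close> to
  \<open>(n + 2) * M\<close> in which \<open>thinned\<close> retains only residues in
  \<open>G\<close>. As the window lies below \<open>L n\<close>, \<open>X\<close> contains none of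
  these. The conclusion has the form that \<open>lower_density_not_posI\<close> asks for.\<close>

lemma thinned_gap:
  assumes G: "G \<subseteq> {..<P n}" "P n \<le> 2 * card G"
    and X: "\<And>s. s < L n \<Longrightarrow> s mod P n \<in> G \<Longrightarrow> s \<notin> X"
  shows "\<exists>M\<ge>n. 1 \<le> M \<and> (thinned \<inter> X) \<inter> {M..<(n + 2) * M} = {}"
proof (intro exI conjI)
  let ?c = "set_encode G"
  let ?M = "P n * (n + 2) ^ ?c"
  have "P n * 1 \<le> ?M" by (intro mult_left_mono) auto
  then show "n \<le> ?M" "1 \<le> ?M" using P_ge[of n] P_pos[of n] by linarith+
  have fin: "finite G" using G(1) finite_subset by blast
  have c: "?c < 2 ^ P n" by (rule set_encode_less[OF G(1)])
  have "s \<notin> X" if s: "s \<in> thinned" "?M \<le> s" "s < (n + 2) * ?M" for s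
  proof -
    have s': "s < P n * (n + 2) ^ (?c + 1)" using s(3) by (simp add: mult_ac)
    then have "s mod P n \<in> G"
      using s(1,2) c G(2) fin unfolding thinned_def
      by (metis (mono_tags, lifting) mem_Collect_eq set_encode_inverse)
    then show ?thesis using X s' window_le[OF c] by simp
  qed
  then show "(thinned \<inter> X) \<inter> {?M..<(n + 2) * ?M} = {}" by auto
qed

text \<open>The part of \<open>x\<close> beyond \<open>b n\<close> follows the shift
  \<open>S\<close> up to a small error, and \<open>S\<close> brings nothing back to coordinate 0,
  which lies below \<open>b n\<close> as \<open>n >= 1\<close>.\<close>

lemma first_coordinate_truncation:
  assumes x: "x \<in> lp" and n: "1 \<le> n" and s: "s \<le> L n"
  shows "norm ((T ^^ s) x 0 - (T ^^ s) (\<lambda>i. if i < b n then x i else 0) 0) \<le> (1/2) ^ n * nrm x"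
proof -
  define q where "q = (\<lambda>i. if i < b n then x i else 0)"
  define r where "r = (\<lambda>i. if i < b n then 0 else x i)"
  have q: "q \<in> lp" by (rule lp_dominated(1)[OF p x]) (simp add: q_def)
  have r: "r \<in> lp" "nrm r \<le> nrm x" by (rule lp_dominated[OF p x]; simp add: r_def)+
  have r0: "r j = 0" if "j < b n" for j using that by (simp add: r_def)
  have "x = (\<lambda>i. q i + r i)" by (auto simp: q_def r_def)
  then have "(T ^^ s) x = (\<lambda>i. (T ^^ s) q i + (T ^^ s) r i)"
    using Tpow_add[OF q r(1), of s] by simp
  moreover have "(S ^^ s) r 0 = 0"
    using b_ge[of n] n by (intro Spow(3)[OF r(1) r0]) auto
  ultimately have "norm ((T ^^ s) x 0 - (T ^^ s) q 0) = norm ((T ^^ s) r 0 - (S ^^ s) r 0)"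
    by simp
  also have "\<dots> \<le> nrm (\<lambda>i. (T ^^ s) r i - (S ^^ s) r i)"
    using lp_coordinate_le[OF p lp_diff(1)[OF p Tpow_lp[OF r(1)] Spow(1)[OF r(1) r0]]] .
  also have "\<dots> \<le> (1/2) ^ n * nrm r" by (rule drift_window(1)[OF r(1) r0 s])
  also have "\<dots> \<le> (1/2) ^ n * nrm x" using r(2) by (intro mult_left_mono) auto
  finally show ?thesis unfolding q_def .
qed

text \<open>The bounds 1 and 2 are at distance 1/2 from the cutoff 3/2, which leaves room for the
  error of truncating \<open>x\<close>.\<close>

definition small_set where "small_set = {z \<in> lp. norm (z 0) < 1}"
definition large_set where "large_set = {z \<in> lp. 2 < norm (z 0)}"

lemma small_set: "lp_open p small_set" "small_set \<noteq> {}"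
proof -
  have "\<exists>e>0. \<forall>z\<in>lp. nrm (\<lambda>n. z n - x n) < e \<longrightarrow> z \<in> small_set" if x: "x \<in> small_set" for x
  proof (intro exI[of _ "1 - norm (x 0)"] conjI ballI impI)
    show "0 < 1 - norm (x 0)" using x by (simp add: small_set_def)
    fix z assume z: "z \<in> lp" "nrm (\<lambda>n. z n - x n) < 1 - norm (x 0)"
    then have "norm (z 0 - x 0) < 1 - norm (x 0)"
      using lp_coordinate_le[OF p lp_diff(1)[OF p z(1), of x], of 0] x by (simp add: small_set_def)
    then show "z \<in> small_set"
      using norm_triangle_ineq2[of "z 0" "x 0"] z(1) by (simp add: small_set_def)
  qed
  then show "lp_open p small_set" by (auto simp: lp_open_def small_set_def)
  have "(\<lambda>_. 0) \<in> small_set" by (simp add: small_set_def)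
  then show "small_set \<noteq> {}" by blast
qed

lemma large_set: "lp_open p large_set" "large_set \<noteq> {}"
proof -
  have "\<exists>e>0. \<forall>z\<in>lp. nrm (\<lambda>n. z n - x n) < e \<longrightarrow> z \<in> large_set" if x: "x \<in> large_set" for x
  proof (intro exI[of _ "norm (x 0) - 2"] conjI ballI impI)
    show "0 < norm (x 0) - 2" using x by (simp add: large_set_def)
    fix z assume z: "z \<in> lp" "nrm (\<lambda>n. z n - x n) < norm (x 0) - 2"
    then have "norm (z 0 - x 0) < norm (x 0) - 2"
      using lp_coordinate_le[OF p lp_diff(1)[OF p z(1), of x], of 0] x by (simp add: large_set_def)
    then show "z \<in> large_set"
      using norm_triangle_ineq2[of "x 0" "z 0"] z(1) by (simp add: large_set_def norm_minus_commute)
  qed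
  then show "lp_open p large_set" by (auto simp: lp_open_def large_set_def)
  have "single 0 3 \<in> large_set" by (simp add: large_set_def) (simp add: single_def)
  then show "large_set \<noteq> {}" by blast
qed

text \<open>Truncating \<open>x\<close> at \<open>b n\<close> gives a vector of period
  \<open>P n\<close>, and one of \<open>G n\<close>, \<open>H n\<close> contains at least half of
  the residues. If \<open>G n\<close> does so for arbitrarily large \<open>n\<close>, visits to
  \<open>large_set\<close> along \<open>thinned\<close> have gaps of growing ratio; otherwise
  \<open>H n\<close> does for all large \<open>n\<close>, and the same holds for
  \<open>small_set\<close>.\<close>

lemma thinned_not_both:
  assumes x: "x \<in> lp"
  shows "\<not> 0 < lower_density (thinned \<inter> return_set T x small_set) \<or>
    \<not> 0 < lower_density (thinned \<inter> return_set T x large_set)"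
proof -
  define q where "q n = (\<lambda>i. if i < b n then x i else 0)" for n
  define G where "G n = {s. s < P n \<and> norm ((T ^^ s) (q n) 0) < 3/2}" for n
  define H where "H n = {s. s < P n \<and> \<not> norm ((T ^^ s) (q n) 0) < 3/2}" for n
  have "q n \<in> E n" for n by (simp add: q_def E_def)
  note qE = this
  have per: "(T ^^ (s mod P n)) (q n) = (T ^^ s) (q n)" for s n
    using periodic_funpow(1)[OF E_periodic[OF qE]] by (rule periodic_mod(2)[where Q = "\<lambda>s. (T ^^ s) (q n)"])
  have "(\<lambda>n. (1/2) ^ n * nrm x) \<longlonglongrightarrow> 0 * nrm x"
    by (intro tendsto_mult LIMSEQ_power_zero tendsto_const) auto
  then have "\<forall>\<^sub>F n in sequentially. (1/2) ^ n * nrm x < 1/2"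
    by (intro order_tendstoD(2)) auto
  then obtain n1 where n1: "\<And>n. n \<ge> n1 \<Longrightarrow> (1/2) ^ n * nrm x < 1/2"
    by (auto simp: eventually_sequentially)
  have close: "norm ((T ^^ s) x 0 - (T ^^ s) (q n) 0) < 1/2" if "n \<ge> max 1 n1" "s < L n" for n s
    using first_coordinate_truncation[OF x, of n s] n1[of n] that unfolding q_def by simp
  have GH: "P n \<le> 2 * card (G n) \<or> P n \<le> 2 * card (H n)" for n
  proof -
    have "card (G n \<union> H n) \<le> card (G n) + card (H n)" by (rule card_Un_le)
    also have "G n \<union> H n = {..<P n}" by (auto simp: G_def H_def)
    finally have "P n \<le> card (G n) + card (H n)" by simp
    then show ?thesis by linarith
  qed
  show ?thesis
  proof (cases "\<forall>n0. \<exists>n\<ge>n0. P n \<le> 2 * card (G n)")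
    case True
    have "\<exists>n\<ge>n0. \<exists>M\<ge>n. 1 \<le> M \<and> (thinned \<inter> return_set T x large_set) \<inter> {M..<(n + 2) * M} = {}" for n0
    proof -
      obtain n where n: "n \<ge> max n0 (max 1 n1)" "P n \<le> 2 * card (G n)" using True by blast
      have "s \<notin> return_set T x large_set" if s: "s < L n" "s mod P n \<in> G n" for s
      proof -
        have "norm ((T ^^ s) (q n) 0) < 3/2" using s(2) per by (simp add: G_def)
        then show ?thesis
          using close[of n s] n s norm_triangle_ineq2[of "(T ^^ s) x 0" "(T ^^ s) (q n) 0"]
          by (simp add: return_set_def large_set_def)
      qed
      note out = this
      have "G n \<subseteq> {..<P n}" "n0 \<le> n" using n(1) by (auto simp: G_def)
      from thinned_gap[OF this(1) n(2) out] this(2) show ?thesis by blast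
    qed
    then show ?thesis by (intro disjI2 lower_density_not_posI)
  next
    case False
    then obtain n2 where n2: "\<And>n. n \<ge> n2 \<Longrightarrow> P n \<le> 2 * card (H n)" using GH by blast
    have "\<exists>n\<ge>n0. \<exists>M\<ge>n. 1 \<le> M \<and> (thinned \<inter> return_set T x small_set) \<inter> {M..<(n + 2) * M} = {}" for n0
    proof -
      define n where "n = max (max n0 n2) (max 1 n1)"
      have n: "n0 \<le> n" "n2 \<le> n" "max 1 n1 \<le> n" by (simp_all add: n_def)
      have out: "s \<notin> return_set T x small_set" if s: "s < L n" "s mod P n \<in> H n" for s
      proof -
        have "\<not> norm ((T ^^ s) (q n) 0) < 3/2" using s(2) per by (simp add: H_def)
        then show ?thesis
          using close[OF n(3), of s] s norm_triangle_ineq2[of "(T ^^ s) (q n) 0" "(T ^^ s) x 0"]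
          by (simp add: return_set_def small_set_def norm_minus_commute)
      qed
      have "H n \<subseteq> {..<P n}" by (auto simp: H_def)
      from thinned_gap[OF this n2[OF n(2)] out] n(1) show ?thesis by blast
    qed
    then show ?thesis by (intro disjI1 lower_density_not_posI)
  qed
qed

lemma not_freq_hypercyclic_along_thinned: "\<not> freq_hypercyclic_along p T thinned"
  using thinned_not_both small_set large_set unfolding freq_hypercyclic_along_def by blast

lemma not_hereditarily_freq_hypercyclic: "\<not> hereditarily_freq_hypercyclic p T"
proof
  assume "hereditarily_freq_hypercyclic p T"
  moreover define V where "V i = (if i = (0::nat) then small_set else large_set)" for i
  moreover have "\<forall>i. lp_open p (V i) \<and> V i \<noteq> {} \<and> 0 < lower_density thinned"
    using small_set large_set lower_density_thinned by (simp add: V_def)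
  ultimately have "\<exists>x\<in>lp. \<forall>i. 0 < lower_density (return_set T x (V i) \<inter> thinned)"
    unfolding hereditarily_freq_hypercyclic_def by (elim allE[of _ V] allE[of _ "\<lambda>_. thinned"]) simp
  then obtain x where x: "x \<in> lp" "\<And>i. 0 < lower_density (return_set T x (V i) \<inter> thinned)"
    by blast
  show False using thinned_not_both[OF x(1)] x(2)[of 0] x(2)[of 1] by (simp add: Int_commute V_def)
qed

end

section \<open>Existence of parameters\<close>

text \<open>The second component of the decoded pair is a dummy: varying it repeats each vector at
  arbitrarily large indices.\<close>

lemma finite_gaussian_enumeration:
  "\<exists>d :: nat \<Rightarrow> nat \<Rightarrow> complex. range d \<subseteq> finite_gaussian \<and> (\<forall>x\<in>finite_gaussian. \<forall>N. \<exists>n\<ge>N. d n = x)"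
proof -
  let ?d = "\<lambda>n. from_nat_into finite_gaussian (fst (prod_decode n))"
  have "\<exists>n\<ge>N. ?d n = x" if "x \<in> finite_gaussian" for x :: "nat \<Rightarrow> complex" and N
  proof -
    have "?d (prod_encode (to_nat_on finite_gaussian x, N)) = x"
      using that countable_finite_gaussian by simp
    then show ?thesis using le_prod_encode_2 by blast
  qed
  moreover have "finite_gaussian \<noteq> {}" using finite_gaussian_zero by blast
  then have "range ?d \<subseteq> finite_gaussian" using from_nat_into by blast
  ultimately show ?thesis by (intro exI[of _ ?d] conjI ballI allI)
qed

lemma block_operator_exists:
  assumes p: "1 \<le> p"
  shows "\<exists>b L P y. block_operator p b L P y"
proof -
  obtain d :: "nat \<Rightarrow> nat \<Rightarrow> complex" where d: "\<And>n. d n \<in> finite_gaussian"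
    and d_dense: "\<And>x N. x \<in> finite_gaussian \<Longrightarrow> \<exists>n\<ge>N. d n = x"
    using finite_gaussian_enumeration by blast
  define K where "K n = nat \<lceil>lp_norm p (d n)\<rceil>" for n
  have K: "lp_norm p (d n) \<le> K n" for n by (simp add: K_def)
  \<comment> \<open>The factor \<open>m\<close> makes \<open>P n\<close> divide \<open>L n\<close>,
    the exponential summand provides \<open>window\<close>, and the rest makes \<open>L n\<close>
    large enough for \<open>y_small\<close>.\<close>
  define g where "g n m = m * ((n + 2) ^ (2 ^ m) + 2 * n + K n + 3)" for n m :: nat
  define P where "P = rec_nat 1 (\<lambda>n m. 16 * g n m)"
  have P: "P 0 = 1" "P (Suc n) = 16 * g n (P n)" for n by (simp_all add: P_def)
  have P_pos: "0 < P n" for n by (induction n) (simp_all add: P g_def)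
  define L where "L n = g n (P n)" for n
  have L_ge: "2 * n + K n + 3 \<le> L n" for n
  proof -
    have "1 * (2 * n + K n + 3) \<le> P n * ((n + 2) ^ (2 ^ P n) + 2 * n + K n + 3)"
      using P_pos[of n] by (intro mult_mono) auto
    then show ?thesis by (simp only: L_def g_def mult_1)
  qed
  define b where "b n = (\<Sum>i<n. 8 * L i)" for n
  have b_ge: "n \<le> b n" for n
  proof -
    have "1 \<le> 8 * L i" for i using L_ge[of i] by simp
    then have "(\<Sum>i<n. 1) \<le> b n" unfolding b_def by (intro sum_mono)
    then show ?thesis by simp
  qed
  \<comment> \<open>A vector not supported below \<open>b n\<close> is replaced by 0. Density is
    kept: each \<open>x\<close> recurs at indices \<open>n\<close> beyond its support, and
    \<open>n <= b n\<close>.\<close>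
  define y where "y n = (if \<forall>j\<ge>b n. d n j = 0 then d n else (\<lambda>_. 0))" for n
  have "block_operator p b L P y"
  proof
    show "1 \<le> p" by (rule p)
    show "b 0 = 0" by (simp add: b_def)
    show "b (Suc n) = b n + 8 * L n" for n by (simp add: b_def)
    show "P 0 = 1" by (rule P)
    show "P (Suc n) = 16 * L n" for n by (simp add: P L_def)
    show "P n dvd L n" for n by (simp add: L_def g_def)
    show "0 < L n" for n using L_ge[of n] by simp
    show "y n \<in> finite_gaussian" for n using d finite_gaussian_zero by (simp add: y_def)
    show "y n j = 0" if "b n \<le> j" for n j using that by (simp add: y_def)
    show "\<exists>n\<ge>N. y n = x" if x: "x \<in> finite_gaussian" for x N
    proof -
      obtain M where M: "\<forall>j\<ge>M. x j = 0" using x by (auto simp: finite_gaussian_def)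
      obtain n where n: "n \<ge> max N M" "d n = x" using d_dense[OF x] by blast
      have "\<forall>j\<ge>b n. d n j = 0" using M n b_ge[of n] by (auto intro: order_trans)
      then show ?thesis using n by (intro exI[of _ n]) (simp add: y_def)
    qed
    show "P n * (n + 2) ^ (2 ^ P n) \<le> L n" for n
      unfolding L_def g_def by (intro mult_left_mono) auto
    show "4 ^ L n * ((1/2) ^ (4 * L n) * lp_norm p (y n) + 2 * (1/2) ^ (8 * L n)) \<le> (1/2) ^ (2 * n + 1)" for n
    proof -
      have "lp_norm p (y n) \<le> K n" using K lp_zero(2)[OF p] by (simp add: y_def)
      moreover have "(1/2::real) ^ (8 * L n) \<le> (1/2) ^ (4 * L n)" by (intro power_decreasing) auto
      ultimately have "4 ^ L n * ((1/2) ^ (4 * L n) * lp_norm p (y n) + 2 * (1/2) ^ (8 * L n))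
          \<le> 4 ^ L n * ((1/2) ^ (4 * L n) * K n + 2 * (1/2) ^ (4 * L n))"
        by (intro mult_left_mono add_mono) auto
      also have "\<dots> = 4 ^ L n * (1/2) ^ (4 * L n) * (K n + 2)" by (simp add: algebra_simps)
      \<comment> \<open>What remains is \<open>(1/2) ^ (2 * L n)\<close>, with
        \<open>2 * L n >= (K n + 2) + (2 * n + 1)\<close>: the first part beats
        \<open>K n + 2 <= 2 ^ (K n + 2)\<close>, the second is the required bound.\<close>
      also have "4 ^ L n * (1/2) ^ (4 * L n) = (1/2::real) ^ (2 * L n)"
      proof -
        have "(16::real) ^ L n = 4 ^ L n * 4 ^ L n" by (simp flip: power_mult_distrib)
        then show ?thesis by (simp add: power_mult power_divide)
      qed
      also have "real (K n + 2) \<le> 2 ^ (K n + 2)"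
        using less_exp[of "K n + 2"] by (metis less_imp_le of_nat_le_iff of_nat_numeral of_nat_power)
      also have "(1/2::real) ^ (2 * L n) * 2 ^ (K n + 2) \<le> (1/2) ^ (K n + 2 + (2 * n + 1)) * 2 ^ (K n + 2)"
        using L_ge[of n] by (intro mult_right_mono power_decreasing) auto
      also have "\<dots> = (1/2) ^ (2 * n + 1)" unfolding power_add[of _ "K n + 2"] by (simp add: power_divide)
      finally show ?thesis by simp
    qed
  qed
  then show ?thesis by blast
qed

theorem theorem5p2:
  fixes p :: real
  assumes "1 \<le> p"
  shows "\<exists>T A. lp_operator p T \<and> lower_density A > 0 \<and>
           freq_hypercyclic p T \<and> chaotic p T \<and>
           \<not> freq_hypercyclic_along p T A \<and> \<not> hereditarily_freq_hypercyclic p T"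
proof -
  obtain b L P y where "block_operator p b L P y" using block_operator_exists[OF assms] by blast
  then interpret block_operator p b L P y .
  show ?thesis
    using lp_operator_T lower_density_thinned freq_hypercyclic_T chaotic_T
      not_freq_hypercyclic_along_thinned not_hereditarily_freq_hypercyclic by blast
qed

end
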